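(* Let $x$ be a vector in $\mathbb{R}^d$ with $s$ nonzero entries. Then the normalized statistical dimension of the descent cone of the $\ell_1$ norm at $x$ satisfies the bounds $$\psi(s/d)-\frac{2}{\sqrt{sd}}\le\frac{\delta(\mathcal{D}(\|\cdot\|_1,x))}{d}\le\psi(s/d).$$ The function $\psi:[0,1]\to[0,1]$ is defined as $$\psi(\rho):=\inf_{\tau\ge0}\left\{\rho(1+\tau^2)+(1-\rho)\int_\tau^\infty(u-\tau)^2\,\varphi(u)\,du\right\}.$$ The integral kernel $\varphi(u):=\sqrt{2/\pi}\,e^{-u^2/2}$ is a probability density supported on $[0,\infty)$. The infimum in the definition of $\psi(\rho)$ is achieved for the unique positive $\tau$ that solves the stationary equation $$\int_\tau^\infty\left(\frac{u}{\tau}-1\right)\varphi(u)\,du=\frac{\rho}{1-\rho}.$$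
   Context: $\|x\|_1=\sum_i|x_i|$. Descent cone: for a proper convex function $f$ on $\mathbb{R}^d$, $\mathcal{D}(f,x):=\bigcup_{\tau>0}\{y\in\mathbb{R}^d: f(x+\tau y)\le f(x)\}$. It is a convex cone, not necessarily closed. A convex cone in $\mathbb{R}^d$ is a convex set $C$ with $C=\tau C$ for all $\tau>0$. For a closed convex cone $C$, $\Pi_C(x)$ denotes the point of $C$ nearest to $x$ in Euclidean norm. Let $g$ be a standard normal vector in $\mathbb{R}^d$. Conic intrinsic volumes: a cone is polyhedral if it is an intersection of finitely many halfspaces. For a polyhedral cone $C\subset\mathbb{R}^d$ and $k=0,\dots,d$, $v_k(C) := \mathbb{P}\{\Pi_C(g)$ lies in the relative interior of a $k$-dimensional face of $C\}$. For a general closed convex cone $C$, $v_k(C):=\lim_{i\to\infty} v_k(C_i)$, where $(C_i)$ is any sequence of polyhedral cones converging to $C$ in the conic Hausdorff metric (identify each closed convex cone with its intersection with the unit sphere $\mathsf{S}^{d-1}$ and use the Hausdorff metric on the sphere); the limit does not depend on the sequence. Statistical dimension: for a closed convex cone $C\subset \mathbb{R}^d$, $\delta(C):=\sum_{k=0}^d k\,v_k(C)$. The statistical dimension of a general convex cone is that of its closure.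
   Formalization: The claim that the infimum is achieved at the unique positive solution of the stationary equation is stated for 0<ρ<1 only: at ρ=0 the equation has no solution, and at ρ=1 its right side is undefined. For s=0 the term 2/√(sd) is read as 0. *)

theory Defs
  imports "HOL-Probability.Probability"
begin

(* The codomain is an arbitrary order, so that both real-valued and extended-real-valued
   (proper) functions are covered. *)
definition descent_cone :: "('a::real_vector \<Rightarrow> 'b::order) \<Rightarrow> 'a \<Rightarrow> 'a set" where
  "descent_cone f x = (\<Union>\<tau>\<in>{0<..}. {y. f (x + \<tau> *\<^sub>R y) \<le> f x})"

definition l1_norm :: "real ^ 'n \<Rightarrow> real" where
  "l1_norm x = (\<Sum>i\<in>UNIV. \<bar>x $ i\<bar>)"

definition std_normal_vector :: "'a::euclidean_space measure" where
  "std_normal_vector = density lborel (\<lambda>x. ennreal (\<Prod>b\<in>Basis. std_normal_density (x \<bullet> b)))"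

(* In the library, a polyhedron is an intersection of finitely many closed affine halfspaces. *)
definition polyhedral_cone :: "'a::euclidean_space set \<Rightarrow> bool" where
  "polyhedral_cone C \<longleftrightarrow> convex_cone C \<and> polyhedron C"

definition polyhedral_intrinsic_volume :: "nat \<Rightarrow> 'a::euclidean_space set \<Rightarrow> real" where
  "polyhedral_intrinsic_volume k C =
     measure std_normal_vector
       {g. \<exists>F. F face_of C \<and> aff_dim F = int k \<and> closest_point C g \<in> rel_interior F}"

(* Hausdorff distance between the traces of two cones on the unit sphere, with respect to the
   angular metric. It takes values in ennreal, where an empty SUP is 0 and an empty INF is top;
   hence the cone {0}, whose trace is empty, is at infinite distance from every other cone. *)
definition conic_hausdorff_dist :: "'a::euclidean_space set \<Rightarrow> 'a set \<Rightarrow> ennreal" where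
  "conic_hausdorff_dist C D =
     max (SUP x\<in>C \<inter> sphere 0 1. INF y\<in>D \<inter> sphere 0 1. ennreal (arccos (x \<bullet> y)))
         (SUP y\<in>D \<inter> sphere 0 1. INF x\<in>C \<inter> sphere 0 1. ennreal (arccos (x \<bullet> y)))"

(* Meaningful for closed convex cones C. Outside the polyhedral case, the value is the common limit
   along all sequences of polyhedral cones converging to C. *)
definition conic_intrinsic_volume :: "nat \<Rightarrow> 'a::euclidean_space set \<Rightarrow> real" where
  "conic_intrinsic_volume k C =
     (if polyhedral_cone C then polyhedral_intrinsic_volume k C
      else (THE l. \<forall>P :: nat \<Rightarrow> 'a set.
              (\<forall>i. polyhedral_cone (P i)) \<and> (\<lambda>i. conic_hausdorff_dist (P i) C) \<longlonglongrightarrow> 0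
              \<longrightarrow> (\<lambda>i. polyhedral_intrinsic_volume k (P i)) \<longlonglongrightarrow> l))"

definition statistical_dimension :: "'a::euclidean_space set \<Rightarrow> real" where
  "statistical_dimension C =
     (\<Sum>k=0..DIM('a). real k * conic_intrinsic_volume k (closure C))"

definition kernel_phi :: "real \<Rightarrow> real" where
  "kernel_phi u = (if 0 \<le> u then sqrt (2 / pi) * exp (- u\<^sup>2 / 2) else 0)"

definition psi_objective :: "real \<Rightarrow> real \<Rightarrow> real" where
  "psi_objective \<rho> \<tau> =
     \<rho> * (1 + \<tau>\<^sup>2) + (1 - \<rho>) * (LINT u:{\<tau>..}|lborel. (u - \<tau>)\<^sup>2 * kernel_phi u)"

definition psi :: "real \<Rightarrow> real" where
  "psi \<rho> = (INF \<tau>\<in>{0..}. psi_objective \<rho> \<tau>)"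

definition stationary :: "real \<Rightarrow> real \<Rightarrow> bool" where
  "stationary \<rho> \<tau> \<longleftrightarrow>
     (LINT u:{\<tau>..}|lborel. (u / \<tau> - 1) * kernel_phi u) = \<rho> / (1 - \<rho>)"

end

theory Submission
  imports Defs
begin

text \<open>
  Write \<open>D\<close> for the descent cone, \<open>P\<close> for the projection onto \<open>D\<close>, and \<open>g\<close> for a standard normal vector.
  For a polyhedral cone, conditioning on the face whose relative interior contains the projection gives
  \<open>\<delta>(D) = E |P g|\<^sup>2\<close>. Let \<open>Q(\<tau>)\<close> be the squared distance of \<open>g\<close> to \<open>\<tau>\<close> times the subdifferential
  of the norm at \<open>x\<close>; its mean is \<open>d\<close> times the function minimised in the definition of \<open>\<psi>(s/d)\<close>, and
  \<open>|P g|\<^sup>2 = min {Q(\<tau>) | \<tau> \<ge> 0}\<close>. This yields the upper bound.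

  For the lower bound, \<open>Q\<close> is strongly convex, with \<open>Q'' \<ge> 2 s\<close>, so \<open>min Q \<ge> Q(\<tau>) - Q'(\<tau>)\<^sup>2 / (4 s)\<close>. At the
  stationary \<open>\<tau>\<close> the mean of \<open>Q'(\<tau>)\<close> vanishes, and \<open>Q'\<close> is a sum of independent terms whose variance is
  bounded by \<open>4 d\<close>, and also by \<open>12 s\<close> because \<open>\<tau> E (|u| - \<tau>)\<^sub>+\<^sup>2 \<le> 2 E (|u| - \<tau>)\<^sub>+\<close>. Hence the gap is at
  most \<open>min 3 (d / s) \<le> 2 sqrt (d / s)\<close>, without recourse to the Gaussian Poincare inequality.
\<close>

subsection \<open>Standard normal vectors\<close>

lemma sets_std_normal_vector [simp, measurable_cong]: "sets std_normal_vector = sets borel"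
  and space_std_normal_vector [simp]: "space std_normal_vector = UNIV"
  by (simp_all add: std_normal_vector_def)

text \<open>Lebesgue measure is the image of the product measure over \<open>Basis\<close> and the
  density factors along the coordinates, so Fubini yields independence of the coordinates in product
  form.\<close>

lemma has_bochner_integral_std_normal_vector_prod:
  fixes f :: "'a::euclidean_space \<Rightarrow> real \<Rightarrow> real"
  assumes f: "\<And>b. b \<in> Basis \<Longrightarrow> integrable (std_normal_distribution) (f b)"
  shows "has_bochner_integral std_normal_vector (\<lambda>x. \<Prod>b\<in>Basis. f b (x \<bullet> b))
           (\<Prod>b\<in>Basis. integral\<^sup>L (std_normal_distribution) (f b))"
proof -
  let ?n = "std_normal_density"
  interpret product_sigma_finite "\<lambda>_::'a. lborel :: real measure" ..
  have fm [measurable]: "f b \<in> borel_measurable borel" if "b \<in> Basis" for b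
    using borel_measurable_integrable[OF f[OF that]] by simp
  have fi: "integrable lborel (\<lambda>t. ?n t * f b t)" if "b \<in> Basis" for b
    using f[OF that] that by (simp add: integrable_density)
  have coord: "(\<Sum>b'\<in>Basis. y b' *\<^sub>R b') \<bullet> b = y b" if "b \<in> Basis" for y and b :: 'a
    using that by (simp add: inner_sum_left inner_Basis if_distrib cong: if_cong)
  have meas [measurable]: "(\<lambda>x::'a. \<Prod>b\<in>Basis. ?n (x \<bullet> b) * f b (x \<bullet> b)) \<in> borel_measurable borel"
    by measurable
  have "has_bochner_integral (\<Pi>\<^sub>M b\<in>(Basis::'a set). lborel)
      (\<lambda>y. \<Prod>b\<in>Basis. ?n (y b) * f b (y b)) (\<Prod>b\<in>Basis. \<integral>t. ?n t * f b t \<partial>lborel)"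
    unfolding has_bochner_integral_iff
    by (intro conjI product_integrable_prod product_integral_prod fi) auto
  then have "has_bochner_integral (\<Pi>\<^sub>M b\<in>(Basis::'a set). lborel)
      (\<lambda>y. \<Prod>b\<in>Basis. ?n ((\<Sum>b\<in>Basis. y b *\<^sub>R b) \<bullet> b) * f b ((\<Sum>b\<in>Basis. y b *\<^sub>R b) \<bullet> b))
      (\<Prod>b\<in>Basis. \<integral>t. ?n t * f b t \<partial>lborel)"
    by (simp add: coord cong: prod.cong)
  then have "has_bochner_integral lborel (\<lambda>x::'a. \<Prod>b\<in>Basis. ?n (x \<bullet> b) * f b (x \<bullet> b))
      (\<Prod>b\<in>Basis. \<integral>t. ?n t * f b t \<partial>lborel)"
    by (subst lborel_eq, intro has_bochner_integral_distr) simp_all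
  then have "has_bochner_integral lborel
      (\<lambda>x::'a. (\<Prod>b\<in>Basis. ?n (x \<bullet> b)) *\<^sub>R (\<Prod>b\<in>Basis. f b (x \<bullet> b)))
      (\<Prod>b\<in>Basis. \<integral>t. ?n t * f b t \<partial>lborel)"
    by (simp add: prod.distrib)
  moreover have "(\<Prod>b\<in>Basis. \<integral>t. ?n t * f b t \<partial>lborel)
      = (\<Prod>b\<in>Basis. integral\<^sup>L (density lborel ?n) (f b))"
    by (intro prod.cong refl) (simp add: integral_density)
  ultimately show ?thesis
    unfolding std_normal_vector_def
    by (intro has_bochner_integral_density) (auto intro!: prod_nonneg)
qed

interpretation std_normal: prob_space "std_normal_distribution"
  by (rule prob_space_normal_density) simp

lemma prob_space_std_normal_vector: "prob_space (std_normal_vector :: 'a::euclidean_space measure)"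
proof
  have "has_bochner_integral (std_normal_vector :: 'a measure) (\<lambda>x. 1) (1::real)"
    using has_bochner_integral_std_normal_vector_prod[of "\<lambda>(b::'a) t. 1"] std_normal.prob_space by simp
  then have "(\<integral>\<^sup>+x. ennreal 1 \<partial>(std_normal_vector :: 'a measure)) = ennreal 1"
    by (subst nn_integral_eq_integral) (auto simp: has_bochner_integral_iff simp del: lebesgue_integral_const)
  then show "emeasure (std_normal_vector :: 'a measure) (space std_normal_vector) = 1"
    by (simp add: nn_integral_const)
qed

interpretation std_normal_vector: prob_space "std_normal_vector :: 'a::euclidean_space measure"
  by (rule prob_space_std_normal_vector)

lemma has_bochner_integral_std_normal_vector_coord:
  fixes b :: "'a::euclidean_space"
  assumes b: "b \<in> Basis" and f: "integrable (std_normal_distribution) (f :: real \<Rightarrow> real)"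
  shows "has_bochner_integral std_normal_vector (\<lambda>x. f (x \<bullet> b))
           (integral\<^sup>L (std_normal_distribution) f)"
proof -
  have "has_bochner_integral std_normal_vector
      (\<lambda>x. \<Prod>b'\<in>Basis. (if b' = b then f else (\<lambda>_. 1)) (x \<bullet> b'))
      (\<Prod>b'\<in>Basis. integral\<^sup>L (std_normal_distribution) (if b' = b then f else (\<lambda>_. 1)))"
    using f by (intro has_bochner_integral_std_normal_vector_prod) auto
  moreover have "(\<Prod>b'\<in>Basis. (if b' = b then f else (\<lambda>_. 1)) (x \<bullet> b')) = f (x \<bullet> b)" for x :: 'a
    using b by (subst prod.remove[of _ b]) (auto intro!: prod.neutral)
  moreover have "(\<Prod>b'\<in>Basis. integral\<^sup>L (std_normal_distribution) (if b' = b then f else (\<lambda>_. 1)))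
      = integral\<^sup>L (std_normal_distribution) f"
    using b std_normal.prob_space by (subst prod.remove[of _ b]) (auto intro!: prod.neutral)
  ultimately show ?thesis by simp
qed

lemma has_bochner_integral_std_normal_vector_coord2:
  fixes a b :: "'a::euclidean_space" and f h :: "real \<Rightarrow> real"
  assumes ab: "a \<in> Basis" "b \<in> Basis" "a \<noteq> b"
    and f: "integrable (std_normal_distribution) f"
    and h: "integrable (std_normal_distribution) h"
  shows "has_bochner_integral std_normal_vector (\<lambda>x. f (x \<bullet> a) * h (x \<bullet> b))
           (integral\<^sup>L (std_normal_distribution) f * integral\<^sup>L (std_normal_distribution) h)"
proof -
  let ?F = "\<lambda>b'. if b' = a then f else if b' = b then h else (\<lambda>_. 1)"
  have split: "prod G Basis = G a * G b" if "\<And>c. c \<noteq> a \<Longrightarrow> c \<noteq> b \<Longrightarrow> G c = 1" for G :: "'a \<Rightarrow> real"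
    using ab that by (subst prod.remove[of _ a], simp, simp, subst prod.remove[of _ b])
      (auto intro!: prod.neutral)
  have "has_bochner_integral std_normal_vector (\<lambda>x. \<Prod>b'\<in>Basis. ?F b' (x \<bullet> b'))
      (\<Prod>b'\<in>Basis. integral\<^sup>L (std_normal_distribution) (?F b'))"
    using f h by (intro has_bochner_integral_std_normal_vector_prod) auto
  then show ?thesis
    using ab std_normal.prob_space by (subst (asm) (1 2) split) auto
qed

section \<open>Linear substitutions in Gaussian integrals\<close>

lemma nn_integral_lborel_shift:
  fixes f :: "'a::euclidean_space \<Rightarrow> ennreal"
  assumes [measurable]: "f \<in> borel_measurable borel"
  shows "(\<integral>\<^sup>+x. f (x + c) \<partial>lborel) = (\<integral>\<^sup>+x. f x \<partial>lborel)"
  by (subst (2) lborel_distr_plus[symmetric, of c]) (simp add: nn_integral_distr add.commute)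

text \<open>Uniqueness of Haar measure up to a factor, in the form obtained by evaluating
  \<open>\<integral>\<integral> f (T x) g y\<close> after the translations \<open>T x \<mapsto> T x + y\<close> and \<open>y \<mapsto> y - T x\<close>.\<close>

lemma nn_integral_lborel_surj_linear:
  fixes T :: "'a::euclidean_space \<Rightarrow> 'a" and f g :: "'a \<Rightarrow> ennreal"
  assumes T: "linear T" and TS: "\<And>y. T (S y) = y"
    and f [measurable]: "f \<in> borel_measurable borel" and g [measurable]: "g \<in> borel_measurable borel"
  shows "(\<integral>\<^sup>+x. f (T x) \<partial>lborel) * (\<integral>\<^sup>+y. g y \<partial>lborel)
       = (\<integral>\<^sup>+x. g (- T x) \<partial>lborel) * (\<integral>\<^sup>+y. f y \<partial>lborel)"
proof -
  have Tm [measurable]: "T \<in> borel_measurable borel"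
    using T by (intro borel_measurable_continuous_onI linear_continuous_on) (simp add: linear_conv_bounded_linear)
  have Tadd: "T (x + S y) = T x + y" for x y
    by (simp add: TS linear_add[OF T])
  have "(\<integral>\<^sup>+x. f (T x) \<partial>lborel) * (\<integral>\<^sup>+y. g y \<partial>lborel) = (\<integral>\<^sup>+y. (\<integral>\<^sup>+x. f (T x) * g y \<partial>lborel) \<partial>lborel)"
    by (simp add: nn_integral_multc nn_integral_cmult)
  also have "\<dots> = (\<integral>\<^sup>+y. (\<integral>\<^sup>+x. f (T x + y) * g y \<partial>lborel) \<partial>lborel)"
  proof (rule nn_integral_cong)
    fix y
    show "(\<integral>\<^sup>+x. f (T x) * g y \<partial>lborel) = (\<integral>\<^sup>+x. f (T x + y) * g y \<partial>lborel)"
      using nn_integral_lborel_shift[of "\<lambda>x. f (T x) * g y" "S y"] by (simp add: Tadd)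
  qed
  also have "\<dots> = (\<integral>\<^sup>+x. (\<integral>\<^sup>+y. f (T x + y) * g y \<partial>lborel) \<partial>lborel)"
    by (rule lborel_pair.Fubini') measurable
  also have "\<dots> = (\<integral>\<^sup>+x. (\<integral>\<^sup>+y. f y * g (y - T x) \<partial>lborel) \<partial>lborel)"
  proof (rule nn_integral_cong)
    fix x
    show "(\<integral>\<^sup>+y. f (T x + y) * g y \<partial>lborel) = (\<integral>\<^sup>+y. f y * g (y - T x) \<partial>lborel)"
      using nn_integral_lborel_shift[of "\<lambda>y. f y * g (y - T x)" "T x"] by (simp add: add.commute)
  qed
  also have "\<dots> = (\<integral>\<^sup>+y. (\<integral>\<^sup>+x. f y * g (y - T x) \<partial>lborel) \<partial>lborel)"
    by (rule lborel_pair.Fubini') measurable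
  \<comment> \<open>The shift by \<open>S y\<close>, a preimage of \<open>y\<close> under
    \<open>T\<close>, removes \<open>y\<close> from the argument of \<open>g\<close>.\<close>
  also have "\<dots> = (\<integral>\<^sup>+y. (\<integral>\<^sup>+x. f y * g (- T x) \<partial>lborel) \<partial>lborel)"
  proof (rule nn_integral_cong)
    fix y
    show "(\<integral>\<^sup>+x. f y * g (y - T x) \<partial>lborel) = (\<integral>\<^sup>+x. f y * g (- T x) \<partial>lborel)"
      using nn_integral_lborel_shift[of "\<lambda>x. f y * g (y - T x)" "S y"] by (simp add: Tadd)
  qed
  also have "\<dots> = (\<integral>\<^sup>+x. g (- T x) \<partial>lborel) * (\<integral>\<^sup>+y. f y \<partial>lborel)"
    by (simp add: nn_integral_cmult nn_integral_multc mult.commute)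
  finally show ?thesis .
qed

lemma std_normal_vector_density_eq:
  "(\<Prod>b\<in>Basis. std_normal_density (x \<bullet> b))
     = (1 / sqrt (2 * pi)) ^ DIM('a) * exp (- (norm x)\<^sup>2 / 2)" for x :: "'a::euclidean_space"
proof -
  have "(\<Prod>b\<in>Basis. std_normal_density (x \<bullet> b))
      = (1 / sqrt (2 * pi)) ^ DIM('a) * exp (\<Sum>b\<in>Basis. - (x \<bullet> b)\<^sup>2 / 2)"
    by (simp add: std_normal_density_def prod.distrib prod_dividef exp_sum power_one_over)
  also have "(\<Sum>b\<in>Basis. - (x \<bullet> b)\<^sup>2 / 2) = - (norm x)\<^sup>2 / 2"
    unfolding norm_eq_sqrt_inner euclidean_inner[of x x]
    by (simp add: sum_nonneg power2_eq_square sum_negf sum_divide_distrib)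
  finally show ?thesis .
qed

text \<open>The Gaussian density \<open>?G\<close> is radial, so
  \<open>?G (T x) = ?G x * exp (- w x)\<close> and the tilted integral is one of
  \<open>?G * indicator A\<close> along \<open>T\<close>. The comparison function is
  \<open>?G\<close> itself, even and of total mass one, so no determinant has to be
  computed.\<close>

lemma nn_integral_std_normal_vector_linear:
  fixes T :: "'a::euclidean_space \<Rightarrow> 'a"
  assumes T: "linear T" and TS: "\<And>y. T (S y) = y" and A [measurable]: "A \<in> sets borel"
    and w: "\<And>x. (norm (T x))\<^sup>2 = (norm x)\<^sup>2 + 2 * w x" and wm [measurable]: "w \<in> borel_measurable borel"
  shows "(\<integral>\<^sup>+x. ennreal (exp (- w x)) * indicator A (T x) \<partial>std_normal_vector)
       = (\<integral>\<^sup>+x. ennreal (exp (- w x)) \<partial>std_normal_vector) * emeasure std_normal_vector A"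
proof -
  let ?G = "\<lambda>x::'a. \<Prod>b\<in>Basis. std_normal_density (x \<bullet> b)"
  have Tm [measurable]: "T \<in> borel_measurable borel"
    using T by (intro borel_measurable_continuous_onI linear_continuous_on) (simp add: linear_conv_bounded_linear)
  have G0: "0 \<le> ?G x" for x by (intro prod_nonneg) simp
  have GT: "?G (T x) = ?G x * exp (- w x)" for x
    by (simp add: std_normal_vector_density_eq w exp_add[symmetric] field_simps)
  have GTm: "?G (- T x) = ?G (T x)" for x
    by (simp only: std_normal_vector_density_eq norm_minus_cancel)
  have dens: "(\<integral>\<^sup>+x. h x \<partial>std_normal_vector) = (\<integral>\<^sup>+x. ennreal (?G x) * h x \<partial>lborel)"
    if [measurable]: "h \<in> borel_measurable borel" for h
    unfolding std_normal_vector_def by (subst nn_integral_density) auto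
  have one: "(\<integral>\<^sup>+x. ennreal (?G x) \<partial>lborel) = 1"
    using dens[of "\<lambda>_. 1"] std_normal_vector.emeasure_space_1[where 'a='a] by simp
  have "(\<integral>\<^sup>+x. ennreal (exp (- w x)) * indicator A (T x) \<partial>std_normal_vector)
      = (\<integral>\<^sup>+x. ennreal (?G (T x)) * indicator A (T x) \<partial>lborel)"
    by (subst dens, measurable) (simp add: GT ennreal_mult G0 mult.assoc)
  also have "\<dots> * (\<integral>\<^sup>+x. ennreal (?G x) \<partial>lborel)
      = (\<integral>\<^sup>+x. ennreal (?G (- T x)) \<partial>lborel) * (\<integral>\<^sup>+x. ennreal (?G x) * indicator A x \<partial>lborel)"
    by (rule nn_integral_lborel_surj_linear[OF T TS]) measurable
  also have "(\<integral>\<^sup>+x. ennreal (?G (- T x)) \<partial>lborel) = (\<integral>\<^sup>+x. ennreal (exp (- w x)) \<partial>std_normal_vector)"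
    by (subst dens, measurable) (intro nn_integral_cong, simp only: GTm GT, rule ennreal_mult[OF G0], simp)
  also have "(\<integral>\<^sup>+x. ennreal (?G x) * indicator A x \<partial>lborel) = emeasure std_normal_vector A"
    using dens[of "indicator A"] by simp
  finally show ?thesis by (simp add: one)
qed

section \<open>Gaussian second moments along subspaces\<close>

lemma has_bochner_integral_std_normal_moment1: "has_bochner_integral std_normal_distribution (\<lambda>t. t) 0"
  and has_bochner_integral_std_normal_moment2: "has_bochner_integral std_normal_distribution (\<lambda>t. t\<^sup>2) 1"
proof -
  show "has_bochner_integral std_normal_distribution (\<lambda>t. t) 0"
    using std_normal_moment_odd[of 0] by (intro has_bochner_integral_density) auto
  show "has_bochner_integral std_normal_distribution (\<lambda>t. t\<^sup>2) 1"
    using std_normal_moment_even[of 1] by (intro has_bochner_integral_density) auto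
qed

text \<open>After expansion in the basis only the diagonal survives, since the coordinates are
  uncorrelated with variance one.\<close>

lemma has_bochner_integral_std_normal_vector_inner_sq:
  fixes v :: "'a::euclidean_space"
  shows "has_bochner_integral std_normal_vector (\<lambda>x. (x \<bullet> v)\<^sup>2) ((norm v)\<^sup>2)"
proof -
  have coord: "has_bochner_integral std_normal_vector (\<lambda>x. (x \<bullet> a) * (x \<bullet> b)) (if a = b then 1 else 0)"
    if "a \<in> Basis" "b \<in> Basis" for a b :: 'a
  proof (cases "a = b")
    case True
    then show ?thesis
      using has_bochner_integral_std_normal_vector_coord[OF that(1), of "\<lambda>t. t\<^sup>2"]
        has_bochner_integral_std_normal_moment2
      by (simp add: has_bochner_integral_iff power2_eq_square)
  next
    case False
    then show ?thesis
      using has_bochner_integral_std_normal_vector_coord2[OF that False, of "\<lambda>t. t" "\<lambda>t. t"]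
        has_bochner_integral_std_normal_moment1
      by (simp add: has_bochner_integral_iff)
  qed
  have "has_bochner_integral std_normal_vector
      (\<lambda>x. \<Sum>a\<in>Basis. \<Sum>b\<in>Basis. ((v \<bullet> a) * (v \<bullet> b)) * ((x \<bullet> a) * (x \<bullet> b)))
      (\<Sum>a\<in>Basis. \<Sum>b\<in>Basis. ((v \<bullet> a) * (v \<bullet> b)) * (if a = b then 1 else 0))"
    by (intro has_bochner_integral_sum has_bochner_integral_mult_right coord)
  moreover have "(\<Sum>a\<in>Basis. \<Sum>b\<in>Basis. ((v \<bullet> a) * (v \<bullet> b)) * ((x \<bullet> a) * (x \<bullet> b))) = (x \<bullet> v)\<^sup>2" for x
    unfolding power2_eq_square euclidean_inner[of x v] sum_product by (simp add: ac_simps)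
  moreover have "(\<Sum>a\<in>Basis. \<Sum>b\<in>Basis. ((v \<bullet> a) * (v \<bullet> b)) * (if a = b then 1 else 0)) = (norm v)\<^sup>2"
    by (simp add: if_distrib norm_eq_sqrt_inner euclidean_inner[of v v] sum_nonneg cong: if_cong)
  ultimately show ?thesis by simp
qed

lemma integrable_std_normal_vector_norm_sq:
  "integrable std_normal_vector (\<lambda>x::'a::euclidean_space. (norm x)\<^sup>2)"
proof -
  have "integrable std_normal_vector (\<lambda>x::'a. \<Sum>b\<in>Basis. (x \<bullet> b)\<^sup>2)"
    by (intro Bochner_Integration.integrable_sum)
      (rule has_bochner_integral_std_normal_vector_inner_sq[THEN has_bochner_integral_iff[THEN iffD1], THEN conjunct1])
  moreover have "(\<Sum>b\<in>Basis. (x \<bullet> b)\<^sup>2) = (norm x)\<^sup>2" for x :: 'a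
    by (simp add: norm_eq_sqrt_inner euclidean_inner[of x x] sum_nonneg power2_eq_square)
  ultimately show ?thesis by simp
qed

text \<open>For \<open>X = |P x|\<^sup>2\<close>, the dilation by \<open>sqrt (1 + 2 r)\<close> along the range of \<open>P\<close> gives
  \<open>E (exp (- r X) ; A) = E (exp (- r X)) * P A\<close>; the claim is the derivative at \<open>r = 0\<close>.\<close>

lemma expectation_norm_proj_sq_indicator:
  fixes P :: "'a::euclidean_space \<Rightarrow> 'a"
  assumes lin: "linear P" and idem: "\<And>x. P (P x) = P x" and adj: "\<And>x y. P x \<bullet> y = x \<bullet> P y"
    and A [measurable]: "A \<in> sets borel"
    and inv: "\<And>t x. 0 < t \<Longrightarrow> x + (t - 1) *\<^sub>R P x \<in> A \<longleftrightarrow> x \<in> A"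
  shows "(\<integral>x. (norm (P x))\<^sup>2 * indicator A x \<partial>std_normal_vector)
       = (\<integral>x. (norm (P x))\<^sup>2 \<partial>std_normal_vector) * measure std_normal_vector A"
proof -
  let ?N = "std_normal_vector :: 'a measure" and ?X = "\<lambda>x. (norm (P x))\<^sup>2"
  have Pm [measurable]: "P \<in> borel_measurable borel"
    using lin by (intro borel_measurable_continuous_onI linear_continuous_on) (simp add: linear_conv_bounded_linear)
  have PX: "x \<bullet> P x = ?X x" for x
    by (metis adj idem power2_norm_eq_inner)
  have Xle: "?X x \<le> (norm x)\<^sup>2" for x
  proof -
    have "norm (P x) * norm (P x) \<le> norm x * norm (P x)"
      using norm_cauchy_schwarz[of x "P x"] PX[of x] by (simp add: power2_eq_square)
    then have "norm (P x) \<le> norm x"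
      by (cases "P x = 0") (auto dest: mult_right_le_imp_le)
    then show ?thesis by (intro power_mono) auto
  qed
  have Xint: "integrable ?N ?X"
    by (rule Bochner_Integration.integrable_bound[OF integrable_std_normal_vector_norm_sq]) (auto simp: Xle)
  have key: "(\<integral>x. exp (- r * ?X x) * indicator A x \<partial>?N) = (\<integral>x. exp (- r * ?X x) \<partial>?N) * measure ?N A"
    if "0 < r" for r
  proof -
    \<comment> \<open>With this \<open>t\<close> the dilation adds
      \<open>(t^2 - 1) * |P x|^2 = 2 * r * |P x|^2\<close> to the squared norm, which produces the
      weight \<open>exp (- r * |P x|^2)\<close>.\<close>
    define t where "t = sqrt (1 + 2 * r)"
    have t: "0 < t" "t\<^sup>2 = 1 + 2 * r" using that by (auto simp: t_def)
    have "(\<integral>\<^sup>+x. ennreal (exp (- (r * ?X x))) * indicator A (x + (t - 1) *\<^sub>R P x) \<partial>?N)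
        = (\<integral>\<^sup>+x. ennreal (exp (- (r * ?X x))) \<partial>?N) * emeasure ?N A"
    proof (rule nn_integral_std_normal_vector_linear)
      show "linear (\<lambda>x. x + (t - 1) *\<^sub>R P x)"
        using lin by (intro linear_compose_add linear_compose_scale_right) (auto simp: linear_id[unfolded id_def])
      have "P (y + (1 / t - 1) *\<^sub>R P y) = (1 / t) *\<^sub>R P y" for y
        by (simp add: linear_add[OF lin] linear_diff[OF lin] linear_scale[OF lin] idem algebra_simps)
      then show "(y + (1 / t - 1) *\<^sub>R P y) + (t - 1) *\<^sub>R P (y + (1 / t - 1) *\<^sub>R P y) = y" for y
        using t by (simp add: diff_divide_distrib scaleR_diff_left algebra_simps)
      show "(norm (x + (t - 1) *\<^sub>R P x))\<^sup>2 = (norm x)\<^sup>2 + 2 * (r * ?X x)" for x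
      proof -
        have "(norm (x + (t - 1) *\<^sub>R P x))\<^sup>2 = (norm x)\<^sup>2 + 2 * (t - 1) * ?X x + (t - 1)\<^sup>2 * ?X x"
          using PX[of x] unfolding power2_norm_eq_inner
          by (simp add: inner_add_left inner_add_right inner_commute[of "P x" x] power2_eq_square
              del: inner_diff_left inner_diff_right) (simp add: algebra_simps)
        also have "\<dots> = (norm x)\<^sup>2 + (t\<^sup>2 - 1) * ?X x"
          by (simp add: power2_eq_square algebra_simps)
        finally show ?thesis by (simp add: t)
      qed
    qed measurable
    \<comment> \<open>Invariance of \<open>A\<close> removes the dilation from the
      indicator.\<close>
    moreover have "ennreal (exp (- (r * ?X x))) * indicator A (x + (t - 1) *\<^sub>R P x)
        = ennreal (exp (- r * ?X x) * indicator A x)" for x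
      using inv[OF t(1), of x] by (cases "x \<in> A") auto
    ultimately have nn: "(\<integral>\<^sup>+x. ennreal (exp (- r * ?X x) * indicator A x) \<partial>?N)
        = (\<integral>\<^sup>+x. ennreal (exp (- r * ?X x)) \<partial>?N) * ennreal (measure ?N A)"
      by (simp add: std_normal_vector.emeasure_eq_measure)
    have i1: "integrable ?N (\<lambda>x. exp (- r * ?X x))"
      by (rule std_normal_vector.integrable_const_bound[of _ 1]) (use that in auto)
    have i2: "integrable ?N (\<lambda>x. exp (- r * ?X x) * indicator A x)"
      by (rule Bochner_Integration.integrable_bound[OF i1]) (auto simp: indicator_def)
    have n1: "(\<integral>\<^sup>+x. ennreal (exp (- r * ?X x)) \<partial>?N) = ennreal (\<integral>x. exp (- r * ?X x) \<partial>?N)"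
      by (rule nn_integral_eq_integral[OF i1]) simp
    have n2: "(\<integral>\<^sup>+x. ennreal (exp (- r * ?X x) * indicator A x) \<partial>?N)
        = ennreal (\<integral>x. exp (- r * ?X x) * indicator A x \<partial>?N)"
      by (rule nn_integral_eq_integral[OF i2]) simp
    have nonneg: "0 \<le> (\<integral>x. exp (- r * ?X x) \<partial>?N)" "0 \<le> (\<integral>x. exp (- r * ?X x) * indicator A x \<partial>?N)"
      by (intro Bochner_Integration.integral_nonneg; simp)+
    then show ?thesis
      using nn unfolding n1 n2 ennreal_mult[OF nonneg(1) measure_nonneg, symmetric]
      by (subst (asm) ennreal_inj) auto
  qed
  \<comment> \<open>Difference quotients of \<open>1 - exp (- r * |P x|^2)\<close> at
    \<open>r = 1 / Suc n\<close>. They lie between 0 and \<open>|P x|^2\<close> and tend to the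
    latter, so dominated convergence performs the differentiation at \<open>r = 0\<close>.\<close>
  define h where "h n x = real (Suc n) * (1 - exp (- (1 / real (Suc n)) * ?X x))" for n x
  have hm [measurable]: "h n \<in> borel_measurable borel" for n
    unfolding h_def[abs_def] by measurable
  have h0: "0 \<le> h n x" for n x
    unfolding h_def by (intro mult_nonneg_nonneg) auto
  have hX: "h n x \<le> ?X x" for n x
  proof -
    have "1 - exp (- (1 / real (Suc n)) * ?X x) \<le> (1 / real (Suc n)) * ?X x"
      using exp_ge_add_one_self[of "- (1 / real (Suc n)) * ?X x"] by simp
    then have "h n x \<le> real (Suc n) * ((1 / real (Suc n)) * ?X x)"
      unfolding h_def by (intro mult_left_mono) auto
    then show ?thesis by (simp del: of_nat_Suc)
  qed
  have hlim: "(\<lambda>n. h n x) \<longlonglongrightarrow> ?X x" for x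
  proof -
    have "((\<lambda>r. (exp (- r * ?X x) - 1) / r) \<longlongrightarrow> - ?X x) (at 0)"
    proof -
      have "((\<lambda>r. exp (- r * ?X x)) has_field_derivative - ?X x) (at 0)"
        by (auto intro!: derivative_eq_intros)
      then show ?thesis by (simp add: DERIV_def)
    qed
    moreover have "filterlim (\<lambda>n. 1 / real (Suc n)) (at 0) sequentially"
      unfolding filterlim_at using LIMSEQ_inverse_real_of_nat by (auto simp: inverse_eq_divide)
    ultimately have "(\<lambda>n. (exp (- (1 / real (Suc n)) * ?X x) - 1) / (1 / real (Suc n))) \<longlonglongrightarrow> - ?X x"
      by (rule filterlim_compose)
    from tendsto_minus[OF this] show ?thesis
      by (simp add: h_def algebra_simps)
  qed
  have hkey: "(\<integral>x. h n x * indicator A x \<partial>?N) = (\<integral>x. h n x \<partial>?N) * measure ?N A" for n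
  proof -
    have i1: "integrable ?N (\<lambda>x. exp (- (1 / real (Suc n)) * ?X x))"
      by (rule std_normal_vector.integrable_const_bound[of _ 1]) auto
    have i2: "integrable ?N (\<lambda>x. exp (- (1 / real (Suc n)) * ?X x) * indicator A x)"
      by (rule Bochner_Integration.integrable_bound[OF i1]) (auto simp: indicator_def)
    have i0: "integrable ?N (indicator A :: 'a \<Rightarrow> real)"
      by (rule std_normal_vector.integrable_const_bound[of _ 1]) auto
    have "(\<integral>x. h n x * indicator A x \<partial>?N)
        = (\<integral>x. real (Suc n) * (indicator A x - exp (- (1 / real (Suc n)) * ?X x) * indicator A x) \<partial>?N)"
      by (intro Bochner_Integration.integral_cong refl) (auto simp: h_def indicator_def)
    also have "\<dots> = real (Suc n) * (measure ?N A - (\<integral>x. exp (- (1 / real (Suc n)) * ?X x) * indicator A x \<partial>?N))"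
      by (subst integral_mult_right_zero, subst Bochner_Integration.integral_diff) (use i0 i2 in auto)
    also have "\<dots> = real (Suc n) * (1 - (\<integral>x. exp (- (1 / real (Suc n)) * ?X x) \<partial>?N)) * measure ?N A"
      by (subst key) (auto simp: algebra_simps)
    also have "real (Suc n) * (1 - (\<integral>x. exp (- (1 / real (Suc n)) * ?X x) \<partial>?N)) = (\<integral>x. h n x \<partial>?N)"
      unfolding h_def[abs_def] by (subst integral_mult_right_zero, subst Bochner_Integration.integral_diff)
        (use i1 std_normal_vector.prob_space[where 'a='a] in auto)
    finally show ?thesis .
  qed
  have "(\<lambda>n. \<integral>x. h n x * indicator A x \<partial>?N) \<longlonglongrightarrow> (\<integral>x. ?X x * indicator A x \<partial>?N)"
    by (rule integral_dominated_convergence[OF _ _ Xint])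
      (auto intro!: tendsto_mult_right hlim simp: indicator_def hX h0)
  moreover have "(\<lambda>n. (\<integral>x. h n x \<partial>?N) * measure ?N A) \<longlonglongrightarrow> (\<integral>x. ?X x \<partial>?N) * measure ?N A"
    by (intro tendsto_mult_right integral_dominated_convergence[OF _ _ Xint])
      (auto intro!: hlim simp: hX h0)
  ultimately show ?thesis
    unfolding hkey by (rule LIMSEQ_unique)
qed

subsection \<open>Statistical dimension of polyhedral cones\<close>

text \<open>Moreau's conditions. The variational inequality for the nearest point, tested at twice
  that point and at the origin, forces orthogonality; what then remains of it is polarity of the
  residual.\<close>

lemma closest_point_convex_cone:
  fixes C :: "'a::euclidean_space set"
  assumes C: "closed C" "convex_cone C"
  shows "closest_point C g \<in> C"
    and "(g - closest_point C g) \<bullet> closest_point C g = 0"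
    and "c \<in> C \<Longrightarrow> (g - closest_point C g) \<bullet> c \<le> 0"
proof -
  let ?p = "closest_point C g"
  have ne: "C \<noteq> {}" and conv: "convex C" and con: "conic C"
    using C by (auto simp: convex_cone_def)
  show p: "?p \<in> C" by (rule closest_point_in_set[OF C(1) ne])
  have le: "(g - ?p) \<bullet> (c - ?p) \<le> 0" if "c \<in> C" for c
    by (rule closest_point_dot[OF conv C(1) that])
  have "(g - ?p) \<bullet> (2 *\<^sub>R ?p - ?p) \<le> 0" "(g - ?p) \<bullet> (0 *\<^sub>R ?p - ?p) \<le> 0"
    by (intro le conicD[OF con p]; simp)+
  then show eq: "(g - ?p) \<bullet> ?p = 0" by (simp add: scaleR_2)
  show "(g - ?p) \<bullet> c \<le> 0" if "c \<in> C" using le[OF that] eq by (simp add: inner_diff_right)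
qed

text \<open>Converse of Moreau's conditions: \<open>|g - z|^2\<close> exceeds
  \<open>|g - p|^2\<close> by
  \<open>|p - z|^2 + 2 * ((g - p) \<bullet> p - (g - p) \<bullet> z)\<close>, which is
  nonnegative.\<close>

lemma closest_point_convex_coneI:
  fixes C :: "'a::euclidean_space set"
  assumes C: "closed C" "convex_cone C" and p: "p \<in> C" and orth: "(g - p) \<bullet> p = 0"
    and polar: "\<And>c. c \<in> C \<Longrightarrow> (g - p) \<bullet> c \<le> 0"
  shows "closest_point C g = p"
proof (rule closest_point_unique[symmetric])
  show "\<forall>z\<in>C. dist g p \<le> dist g z"
  proof
    fix z assume z: "z \<in> C"
    have "0 \<le> 2 * ((g - p) \<bullet> p - (g - p) \<bullet> z)" using orth polar[OF z] by simp
    then have "(dist g p)\<^sup>2 \<le> (dist g p)\<^sup>2 + (norm (p - z))\<^sup>2 + 2 * ((g - p) \<bullet> p - (g - p) \<bullet> z)"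
      by (simp add: add_nonneg_nonneg)
    also have "\<dots> = (dist g z)\<^sup>2"
      unfolding dist_norm power2_norm_eq_inner by (simp add: inner_diff_left inner_diff_right inner_commute)
    finally show "dist g p \<le> dist g z" by (rule power2_le_imp_le) simp
  qed
qed (use C p in \<open>auto simp: convex_cone_def\<close>)

lemma rel_interior_conic:
  fixes F :: "'a::euclidean_space set"
  assumes F: "conic F" and t: "0 < t"
  shows "t *\<^sub>R x \<in> rel_interior F \<longleftrightarrow> x \<in> rel_interior F"
proof -
  have sub: "t *\<^sub>R x \<in> rel_interior F" if x: "x \<in> rel_interior F" and t: "0 < t" for t x
  proof -
    have "(*\<^sub>R) t ` F = F"
    proof
      show "(*\<^sub>R) t ` F \<subseteq> F" using conicD[OF F] t by auto
      show "F \<subseteq> (*\<^sub>R) t ` F"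
      proof
        fix y assume "y \<in> F"
        then have "inverse t *\<^sub>R y \<in> F" using conicD[OF F, of y "inverse t"] t by simp
        moreover have "y = t *\<^sub>R (inverse t *\<^sub>R y)" using t by simp
        ultimately show "y \<in> (*\<^sub>R) t ` F" by blast
      qed
    qed
    then show ?thesis using x rel_interior_scaleR[of t F] t by auto
  qed
  show ?thesis using sub[of x t] sub[of "t *\<^sub>R x" "inverse t"] t by auto
qed

text \<open>Descent through facets: a point outside the relative interior lies on a facet, which has
  smaller dimension. The induction measure is shifted by one because the empty set has affine
  dimension -1.\<close>

lemma ex_face_of_rel_interior:
  fixes S :: "'a::euclidean_space set"
  assumes "polyhedron S" "x \<in> S"
  shows "\<exists>F. F face_of S \<and> x \<in> rel_interior F"
  using assms
proof (induction "nat (aff_dim S + 1)" arbitrary: S rule: less_induct)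
  case less
  show ?case
  proof (cases "x \<in> rel_interior S")
    case True
    then show ?thesis using less.prems face_of_refl polyhedron_imp_convex by blast
  next
    case False
    then have "x \<in> \<Union> {F. F facet_of S}"
      using rel_boundary_of_polyhedron[OF less.prems(1)] less.prems(2) by blast
    then obtain F where F: "F facet_of S" "x \<in> F" by blast
    have "nat (aff_dim F + 1) < nat (aff_dim S + 1)"
      using F aff_dim_geq[of F] by (auto simp: facet_of_def)
    moreover have FS: "F face_of S" using F by (simp add: facet_of_def)
    ultimately obtain G where "G face_of F" "x \<in> rel_interior G"
      using less.hyps[of F] F face_of_polyhedron_polyhedron[OF less.prems(1) FS] by blast
    then show ?thesis using face_of_trans FS by blast
  qed
qed

section \<open>Conditioning on the face that receives the projection\<close>

text \<open>\<open>P\<close> is built from an orthonormal basis of \<open>L\<close>; the squared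
  length of \<open>P x\<close> is the sum of the squared coordinates along it, each of mean
  one.\<close>

lemma ex_orthogonal_projection:
  fixes L :: "'a::euclidean_space set"
  assumes L: "subspace L"
  obtains P where "linear P" "\<And>x. P (P x) = P x" "\<And>x y. P x \<bullet> y = x \<bullet> P y"
    "\<And>x. P x \<in> L" "\<And>x. x \<in> L \<Longrightarrow> P x = x"
    "(\<integral>x. (norm (P x))\<^sup>2 \<partial>std_normal_vector) = real (dim L)"
proof -
  obtain B where B: "B \<subseteq> L" "pairwise orthogonal B" "\<And>b. b \<in> B \<Longrightarrow> norm b = 1"
    "independent B" "card B = dim L" "span B = L"
    using orthonormal_basis_subspace[OF L] by metis
  have fin: "finite B" using B(4) independent_imp_finite by blast
  have orth: "b \<bullet> c = (if b = c then 1 else 0)" if "b \<in> B" "c \<in> B" for b c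
    using that B(2,3) by (auto simp: pairwise_def orthogonal_def norm_eq_1)
  define P where "P x = (\<Sum>b\<in>B. (x \<bullet> b) *\<^sub>R b)" for x
  have lin: "linear P"
    unfolding P_def by (intro linear_compose_sum ballI linearI) (auto simp: inner_add_left scaleR_add_left)
  have Pb: "P x \<bullet> b = x \<bullet> b" if "b \<in> B" for x b
    using that fin by (simp add: P_def inner_sum_left orth if_distrib cong: if_cong)
  have idem: "P (P x) = P x" for x
    unfolding P_def[of "P x"] by (simp add: Pb) (simp add: P_def)
  have adj: "P x \<bullet> y = x \<bullet> P y" for x y
    by (simp add: P_def inner_sum_left inner_sum_right inner_commute mult.commute)
  have PL: "P x \<in> L" for x
    unfolding P_def using B(1) L by (intro subspace_sum subspace_scale) auto
  have fixed: "P x = x" if "x \<in> L" for x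
  proof -
    have "P b = id b" if "b \<in> B" for b
      using that fin by (simp add: P_def orth if_distrib if_distribR cong: if_cong)
    then have "P x = id x"
      using linear_eq_on[OF lin linear_id] that B(6) by blast
    then show ?thesis by simp
  qed
  have "(norm (P x))\<^sup>2 = (\<Sum>b\<in>B. (x \<bullet> b)\<^sup>2)" for x
  proof -
    have "(norm (P x))\<^sup>2 = x \<bullet> P x" by (metis adj idem power2_norm_eq_inner)
    then show ?thesis by (simp add: P_def inner_sum_right power2_eq_square)
  qed
  moreover have "(\<integral>x. (\<Sum>b\<in>B. (x \<bullet> b)\<^sup>2) \<partial>std_normal_vector) = (\<Sum>b\<in>B. (norm b)\<^sup>2)"
    by (intro has_bochner_integral_integral_eq has_bochner_integral_sum has_bochner_integral_std_normal_vector_inner_sq)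
  ultimately have "(\<integral>x. (norm (P x))\<^sup>2 \<partial>std_normal_vector) = real (dim L)"
    using B by simp
  with lin idem adj PL fixed show thesis using that by blast
qed

text \<open>On the event that the projection onto \<open>C\<close> falls into the relative interior of \<open>F\<close>, it
  coincides with the orthogonal projection onto the span of \<open>F\<close>, and the event is invariant under
  dilations of the span.\<close>

lemma expectation_closest_point_sq_face:
  fixes C F :: "'a::euclidean_space set"
  assumes C: "closed C" "convex_cone C" and F: "F face_of C" "F \<noteq> {}"
  shows "(\<integral>g. (norm (closest_point C g))\<^sup>2 * indicator {g. closest_point C g \<in> rel_interior F} g \<partial>std_normal_vector)
       = aff_dim F * measure std_normal_vector {g. closest_point C g \<in> rel_interior F}"
    and "{g. closest_point C g \<in> rel_interior F} \<in> sets borel"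
proof -
  let ?A = "{g. closest_point C g \<in> rel_interior F}"
  have ne: "C \<noteq> {}" and conv: "convex C" and con: "conic C"
    using C by (auto simp: convex_cone_def)
  have Fcon: "conic F" using face_of_conic[OF con F(1)] .
  have FC: "F \<subseteq> C" using F(1) face_of_imp_subset by blast
  \<comment> \<open>A nonempty conic face contains the origin, so its affine hull is its span and
    \<open>aff_dim F\<close> is the dimension of that span.\<close>
  have F0: "0 \<in> affine hull F"
    using Fcon F(2) conic_contains_0 hull_inc by metis
  obtain P where P: "linear P" "\<And>x. P (P x) = P x" "\<And>x y. P x \<bullet> y = x \<bullet> P y"
    "\<And>x. P x \<in> span F" "\<And>x. x \<in> span F \<Longrightarrow> P x = x"
    "(\<integral>x. (norm (P x))\<^sup>2 \<partial>std_normal_vector) = real (dim (span F))"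
    by (rule ex_orthogonal_projection[OF subspace_span[of F]]) (rule that)
  \<comment> \<open>For measurability: the relative interior is a closed set minus its closed
    relative frontier.\<close>
  have "closed F" using face_of_imp_closed[OF conv C(1) F(1)] .
  moreover from this have "rel_interior F = F - rel_frontier F"
    using rel_interior_subset[of F] by (auto simp: rel_frontier_def)
  ultimately have "rel_interior F \<in> sets borel"
    using closed_rel_frontier[of F] by simp
  moreover have "closest_point C \<in> borel_measurable borel"
    by (intro borel_measurable_continuous_onI continuous_on_closest_point conv C(1) ne)
  ultimately show meas: "?A \<in> sets borel"
    using measurable_sets[of "closest_point C" borel borel "rel_interior F"] by (simp add: vimage_def)
  have orth: "(g - closest_point C g) \<bullet> v = 0" if g: "g \<in> ?A" and v: "v \<in> span F" for g v
  proof -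
    let ?p = "closest_point C g"
    \<comment> \<open>From a relatively interior point a small multiple of \<open>v\<close> can be
      added without leaving \<open>F\<close>, so polarity gives the sign. Applied to
      \<open>- v\<close> as well, it gives orthogonality.\<close>
    have nonpos: "(g - ?p) \<bullet> v \<le> 0" if v: "v \<in> span F" for v
    proof -
      obtain e where e: "0 < e" "ball ?p e \<inter> affine hull F \<subseteq> F"
        using g mem_rel_interior_ball by blast
      define u where "u = e / (2 * (norm v + 1))"
      have u: "0 < u" "u * norm v < e"
      proof -
        have "0 < norm v + 1" using norm_ge_zero[of v] by linarith
        then show "0 < u" "u * norm v < e"
          using e(1) by (auto simp: u_def field_simps intro: add_nonneg_pos)
      qed
      have "?p \<in> span F" using g rel_interior_subset span_superset by blast
      then have "?p + u *\<^sub>R v \<in> affine hull F"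
        unfolding affine_hull_span_0[OF F0] using v by (intro span_add span_scale)
      moreover have "?p + u *\<^sub>R v \<in> ball ?p e"
        using u by (simp add: dist_norm)
      ultimately have "?p + u *\<^sub>R v \<in> C" using e FC by blast
      then have "(g - ?p) \<bullet> (?p + u *\<^sub>R v) \<le> 0" by (rule closest_point_convex_cone(3)[OF C])
      then have "u * ((g - ?p) \<bullet> v) \<le> 0"
        using closest_point_convex_cone(2)[OF C, of g] by (simp add: inner_add_right)
      then show ?thesis using u(1) by (simp add: mult_le_0_iff)
    qed
    show ?thesis using nonpos[OF v] nonpos[OF span_neg[OF v]] by simp
  qed
  have proj: "P g = closest_point C g" if g: "g \<in> ?A" for g
  proof -
    let ?p = "closest_point C g"
    have p: "?p \<in> span F" using g rel_interior_subset span_superset by blast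
    have "(norm (P (g - ?p)))\<^sup>2 = (g - ?p) \<bullet> P (g - ?p)"
      by (metis P(2,3) power2_norm_eq_inner)
    also have "\<dots> = 0" by (rule orth[OF g P(4)])
    finally have "P (g - ?p) = 0" by simp
    then show ?thesis using linear_diff[OF P(1)] P(5)[OF p] by simp
  qed
  \<comment> \<open>The dilation keeps the residual \<open>g - ?p\<close> and replaces
    \<open>?p\<close> by its multiple by \<open>t\<close>, so Moreau's conditions persist.\<close>
  have dil: "g + (t - 1) *\<^sub>R P g \<in> ?A" if g: "g \<in> ?A" and t: "0 < t" for t g
  proof -
    let ?p = "closest_point C g"
    have "closest_point C (g + (t - 1) *\<^sub>R ?p) = t *\<^sub>R ?p"
    proof (rule closest_point_convex_coneI[OF C])
      have eq: "g + (t - 1) *\<^sub>R ?p - t *\<^sub>R ?p = g - ?p" by (simp add: algebra_simps)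
      show "t *\<^sub>R ?p \<in> C" using conicD[OF con closest_point_convex_cone(1)[OF C]] t by simp
      show "(g + (t - 1) *\<^sub>R ?p - t *\<^sub>R ?p) \<bullet> t *\<^sub>R ?p = 0"
        unfolding eq inner_scaleR_right closest_point_convex_cone(2)[OF C] by simp
      show "(g + (t - 1) *\<^sub>R ?p - t *\<^sub>R ?p) \<bullet> c \<le> 0" if "c \<in> C" for c
        unfolding eq by (rule closest_point_convex_cone(3)[OF C that])
    qed
    then show ?thesis using g t proj[OF g] rel_interior_conic[OF Fcon t] by simp
  qed
  have inv: "g + (t - 1) *\<^sub>R P g \<in> ?A \<longleftrightarrow> g \<in> ?A" if t: "0 < t" for t g
  proof
    let ?h = "g + (t - 1) *\<^sub>R P g"
    assume h: "?h \<in> ?A"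
    have "P ?h = t *\<^sub>R P g"
      by (simp add: linear_add[OF P(1)] linear_diff[OF P(1)] linear_scale[OF P(1)] P(2) algebra_simps)
    \<comment> \<open>Dilation by \<open>1 / t\<close> undoes dilation by \<open>t\<close>, so one
      inclusion yields the other.\<close>
    then have "?h + (1 / t - 1) *\<^sub>R P ?h = g" using t by (simp add: algebra_simps)
    moreover have "?h + (1 / t - 1) *\<^sub>R P ?h \<in> ?A" by (rule dil[OF h]) (use t in simp)
    ultimately show "g \<in> ?A" by (simp only:)
  qed (use dil t in blast)
  have "(\<integral>g. (norm (closest_point C g))\<^sup>2 * indicator ?A g \<partial>std_normal_vector)
      = (\<integral>g. (norm (P g))\<^sup>2 * indicator ?A g \<partial>std_normal_vector)"
    by (intro Bochner_Integration.integral_cong refl) (auto simp: proj indicator_def)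
  also have "\<dots> = (\<integral>g. (norm (P g))\<^sup>2 \<partial>std_normal_vector) * measure std_normal_vector ?A"
    by (rule expectation_norm_proj_sq_indicator[OF P(1-3) meas inv])
  also have "\<dots> = aff_dim F * measure std_normal_vector ?A"
    by (simp add: P(6) aff_dim_zero[OF F0])
  finally show "(\<integral>g. (norm (closest_point C g))\<^sup>2 * indicator ?A g \<partial>std_normal_vector)
      = aff_dim F * measure std_normal_vector ?A" .
qed

text \<open>The relative interiors of the nonempty faces partition \<open>C\<close>, so the events
  \<open>A F\<close> partition the space. Each intrinsic volume is a sum of their probabilities, and
  \<open>aff_dim F\<close> times such a probability is the expectation of the squared norm over
  \<open>A F\<close>; summation over the faces gives the full expectation.\<close>

lemma statistical_dimension_polyhedral_cone:
  fixes C :: "'a::euclidean_space set"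
  assumes "polyhedral_cone C"
  shows "statistical_dimension C = (\<integral>g. (norm (closest_point C g))\<^sup>2 \<partial>std_normal_vector)"
    and "integrable std_normal_vector (\<lambda>g. (norm (closest_point C g))\<^sup>2)"
proof -
  let ?N = "std_normal_vector :: 'a measure"
  have C: "convex_cone C" "polyhedron C" using assms by (auto simp: polyhedral_cone_def)
  have cl: "closed C" using C(2) polyhedron_imp_closed by blast
  have ne: "C \<noteq> {}" and conv: "convex C" using C by (auto simp: convex_cone_def)
  define A where "A F = {g. closest_point C g \<in> rel_interior F}" for F
  define \<F> where "\<F> = {F. F face_of C \<and> F \<noteq> {}}"
  have fin: "finite \<F>"
    unfolding \<F>_def by (rule finite_subset[OF _ finite_polyhedron_faces[OF C(2)]]) auto
  note face = expectation_closest_point_sq_face[OF cl C(1), folded A_def]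
  have Am [measurable]: "A F \<in> sets borel" if "F \<in> \<F>" for F
    using face(2) that by (auto simp: \<F>_def)
  have disj: "disjoint_family_on A \<F>"
    unfolding disjoint_family_on_def A_def \<F>_def using face_of_eq by blast
  have cm [measurable]: "closest_point C \<in> borel_measurable borel"
    by (intro borel_measurable_continuous_onI continuous_on_closest_point conv cl ne)
  have le: "norm (closest_point C g) \<le> norm g" for g
  proof -
    have "norm (closest_point C g) * norm (closest_point C g) \<le> norm g * norm (closest_point C g)"
      using norm_cauchy_schwarz[of g "closest_point C g"] closest_point_convex_cone(2)[OF cl C(1), of g]
      by (simp add: inner_diff_left dot_square_norm power2_eq_square)
    then show ?thesis by (cases "closest_point C g = 0") (auto dest: mult_right_le_imp_le)
  qed
  show int: "integrable ?N (\<lambda>g. (norm (closest_point C g))\<^sup>2)"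
    by (rule Bochner_Integration.integrable_bound[OF integrable_std_normal_vector_norm_sq])
      (auto intro!: power_mono le)
  have v: "polyhedral_intrinsic_volume k C = (\<Sum>F\<in>{F\<in>\<F>. aff_dim F = int k}. measure ?N (A F))" for k
  proof -
    have "{g. \<exists>F. F face_of C \<and> aff_dim F = int k \<and> closest_point C g \<in> rel_interior F}
        = (\<Union>F\<in>{F\<in>\<F>. aff_dim F = int k}. A F)"
      by (auto simp: A_def \<F>_def)
    also have "measure ?N \<dots> = (\<Sum>F\<in>{F\<in>\<F>. aff_dim F = int k}. measure ?N (A F))"
      using fin disj by (intro std_normal_vector.finite_measure_finite_Union)
        (auto simp: disjoint_family_on_def)
    finally show ?thesis by (simp add: polyhedral_intrinsic_volume_def)
  qed
  have dim: "nat (aff_dim F) \<in> {0..DIM('a)}" "0 \<le> aff_dim F" if "F \<in> \<F>" for F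
    using that aff_dim_le_DIM[of F] aff_dim_geq[of F] aff_dim_empty[of F] by (auto simp: \<F>_def)
  have "statistical_dimension C = (\<Sum>k=0..DIM('a). real k * polyhedral_intrinsic_volume k C)"
    using assms cl by (simp add: statistical_dimension_def conic_intrinsic_volume_def closure_closed)
  also have "\<dots> = (\<Sum>k=0..DIM('a). \<Sum>F\<in>{F\<in>\<F>. nat (aff_dim F) = k}. aff_dim F * measure ?N (A F))"
  proof (intro sum.cong refl)
    fix k
    have "{F\<in>\<F>. aff_dim F = int k} = {F\<in>\<F>. nat (aff_dim F) = k}" using dim(2) by auto
    then show "real k * polyhedral_intrinsic_volume k C
        = (\<Sum>F\<in>{F\<in>\<F>. nat (aff_dim F) = k}. aff_dim F * measure ?N (A F))"
      unfolding v sum_distrib_left using dim(2) by (intro sum.cong) auto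
  qed
  also have "\<dots> = (\<Sum>F\<in>\<F>. aff_dim F * measure ?N (A F))"
    by (rule sum.group[OF fin]) (use dim in auto)
  also have "\<dots> = (\<Sum>F\<in>\<F>. \<integral>g. (norm (closest_point C g))\<^sup>2 * indicator (A F) g \<partial>?N)"
    by (intro sum.cong refl) (auto simp: \<F>_def face(1))
  also have "\<dots> = (\<integral>g. (\<Sum>F\<in>\<F>. (norm (closest_point C g))\<^sup>2 * indicator (A F) g) \<partial>?N)"
    by (rule Bochner_Integration.integral_sum[symmetric])
      (rule Bochner_Integration.integrable_bound[OF int], auto simp: indicator_def)
  also have "\<dots> = (\<integral>g. (norm (closest_point C g))\<^sup>2 \<partial>?N)"
  proof (intro Bochner_Integration.integral_cong refl)
    fix g
    obtain F where F: "F face_of C" "closest_point C g \<in> rel_interior F"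
      using ex_face_of_rel_interior[OF C(2) closest_point_in_set[OF cl ne]] by blast
    then have FF: "F \<in> \<F>" using rel_interior_subset by (auto simp: \<F>_def)
    have "(\<Sum>G\<in>\<F>. (norm (closest_point C g))\<^sup>2 * indicator (A G) g)
        = (\<Sum>G\<in>\<F>. if G = F then (norm (closest_point C g))\<^sup>2 else 0)"
    proof (intro sum.cong refl)
      fix G assume "G \<in> \<F>"
      then have "g \<in> A G \<longleftrightarrow> G = F"
        using face_of_eq F by (auto simp: A_def \<F>_def)
      then show "(norm (closest_point C g))\<^sup>2 * indicator (A G) g = (if G = F then (norm (closest_point C g))\<^sup>2 else 0)"
        by (cases "G = F") (simp_all add: indicator_def)
    qed
    then show "(\<Sum>G\<in>\<F>. (norm (closest_point C g))\<^sup>2 * indicator (A G) g) = (norm (closest_point C g))\<^sup>2"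
      using FF fin by simp
  qed
  finally show "statistical_dimension C = (\<integral>g. (norm (closest_point C g))\<^sup>2 \<partial>?N)" .
qed

subsection \<open>Truncated Gaussian moments and the function \<open>\<psi>\<close>\<close>

text \<open>Moments of a soft-thresholded standard normal variable. The two-sided form suits the
  coordinates of \<open>g\<close>; folding at the origin turns it into one-sided integrals against
  \<open>kernel_phi\<close>.\<close>

definition excess :: "nat \<Rightarrow> real \<Rightarrow> real" where
  "excess k \<tau> = (\<integral>t. (max (\<bar>t\<bar> - \<tau>) 0) ^ k \<partial>std_normal_distribution)"

lemma integrable_excess [simp]:
  assumes "0 \<le> \<tau>"
  shows "integrable std_normal_distribution (\<lambda>t. (max (\<bar>t\<bar> - \<tau>) 0) ^ k)"
proof (rule Bochner_Integration.integrable_bound)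
  show "integrable std_normal_distribution (\<lambda>t. \<bar>t\<bar> ^ k)"
    using integrable_std_normal_moment_abs[of k] by (simp add: integrable_density)
  show "AE t in std_normal_distribution. norm ((max (\<bar>t\<bar> - \<tau>) 0) ^ k) \<le> norm (\<bar>t\<bar> ^ k)"
    using assms by (intro AE_I2) (auto intro!: power_mono)
qed measurable

lemma integrable_excess1 [simp]:
  "0 \<le> \<tau> \<Longrightarrow> integrable std_normal_distribution (\<lambda>t. max (\<bar>t\<bar> - \<tau>) 0)"
  using integrable_excess[of \<tau> 1] by simp

lemma excess_nonneg: "0 \<le> excess k \<tau>"
  unfolding excess_def by (intro Bochner_Integration.integral_nonneg) auto

lemma excess2_0: "excess 2 0 = 1"
  using has_bochner_integral_std_normal_moment2 by (simp add: excess_def has_bochner_integral_iff)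

lemma excess1_0: "0 < excess 1 0"
  using integral_std_normal_moment_abs_odd[of 0]
  by (simp add: excess_def integral_density)

lemma excess_antimono:
  assumes "0 \<le> \<sigma>" "\<sigma> \<le> \<tau>"
  shows "excess k \<tau> \<le> excess k \<sigma>"
  unfolding excess_def using assms
  by (intro integral_mono integrable_excess power_mono) auto

lemma excess1_lipschitz:
  assumes "0 \<le> \<sigma>" "\<sigma> \<le> \<tau>"
  shows "excess 1 \<sigma> - excess 1 \<tau> \<le> \<tau> - \<sigma>"
proof -
  have "excess 1 \<sigma> - excess 1 \<tau> = (\<integral>t. max (\<bar>t\<bar> - \<sigma>) 0 - max (\<bar>t\<bar> - \<tau>) 0 \<partial>std_normal_distribution)"
    unfolding excess_def using assms by simp
  also have "\<dots> \<le> (\<integral>t. \<tau> - \<sigma> \<partial>std_normal_distribution)"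
    using assms by (intro integral_mono) auto
  finally show ?thesis using std_normal.prob_space by simp
qed

lemma continuous_on_excess1: "continuous_on {0..} (excess 1)"
proof (rule continuous_onI)
  fix \<tau> e :: real assume "\<tau> \<in> {0..}" "0 < e"
  then show "\<exists>d>0. \<forall>\<sigma>\<in>{0..}. dist \<sigma> \<tau> < d \<longrightarrow> dist (excess 1 \<sigma>) (excess 1 \<tau>) \<le> e"
    using excess1_lipschitz[of \<tau>] excess1_lipschitz[of _ \<tau>] excess_antimono[of \<tau> _ 1] excess_antimono[of _ \<tau> 1]
    by (intro exI[of _ e] conjI ballI impI) (smt (verit) atLeast_iff dist_real_def)+
qed

text \<open>The squared positive part of \<open>b - \<tau>\<close> is convex in \<tau> with
  derivative \<open>- 2 * max (b - \<tau>) 0\<close>; the left side is its tangent at \<tau>,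
  evaluated at \<sigma>. It serves both the minimisation defining \<open>psi\<close> and the strong
  convexity of the residual norm.\<close>

lemma pos_part_sq_tangent:
  fixes b \<sigma> \<tau> :: real
  shows "(max (b - \<tau>) 0)\<^sup>2 - 2 * (\<sigma> - \<tau>) * max (b - \<tau>) 0 \<le> (max (b - \<sigma>) 0)\<^sup>2"
proof (cases "b \<le> \<tau>")
  case False
  have "(max (b - \<tau>) 0)\<^sup>2 - 2 * (\<sigma> - \<tau>) * max (b - \<tau>) 0 = (b - \<sigma>)\<^sup>2 - (\<sigma> - \<tau>)\<^sup>2"
    using False by (simp add: power2_eq_square algebra_simps)
  also have "\<dots> \<le> (max (b - \<sigma>) 0)\<^sup>2"
  proof (cases "b \<le> \<sigma>")
    case True
    then have "(\<sigma> - b)\<^sup>2 \<le> (\<sigma> - \<tau>)\<^sup>2" using False by (intro power_mono) auto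
    then show ?thesis using True by (simp add: power2_commute)
  qed auto
  finally show ?thesis .
qed simp

lemma excess2_tangent:
  assumes "0 \<le> \<sigma>" "0 \<le> \<tau>"
  shows "excess 2 \<tau> - 2 * excess 1 \<tau> * (\<sigma> - \<tau>) \<le> excess 2 \<sigma>"
proof -
  have "excess 2 \<tau> - 2 * excess 1 \<tau> * (\<sigma> - \<tau>)
      = (\<integral>t. (max (\<bar>t\<bar> - \<tau>) 0)\<^sup>2 - 2 * (\<sigma> - \<tau>) * max (\<bar>t\<bar> - \<tau>) 0 \<partial>std_normal_distribution)"
    unfolding excess_def using assms by (simp add: algebra_simps)
  also have "\<dots> \<le> excess 2 \<sigma>"
    unfolding excess_def using assms by (intro integral_mono pos_part_sq_tangent) auto
  finally show ?thesis .
qed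

section \<open>The half-normal kernel\<close>

lemma kernel_phi_eq: "kernel_phi u = 2 * indicator {0..} u * std_normal_density u"
  by (simp add: kernel_phi_def std_normal_density_def real_sqrt_divide real_sqrt_mult)
    (simp add: field_simps flip: power2_eq_square)

lemma kernel_phi_measurable [measurable]: "kernel_phi \<in> borel_measurable borel"
  unfolding kernel_phi_def[abs_def] by measurable

text \<open>\<open>kernel_phi\<close> is the density of the absolute value of a standard normal
  variable: by evenness both half-lines contribute equally.\<close>

lemma has_bochner_integral_kernel_phi:
  fixes f :: "real \<Rightarrow> real"
  assumes f [measurable]: "f \<in> borel_measurable borel"
    and int: "integrable std_normal_distribution (\<lambda>t. f \<bar>t\<bar>)"
  shows "has_bochner_integral lborel (\<lambda>u. kernel_phi u * f u) (\<integral>t. f \<bar>t\<bar> \<partial>std_normal_distribution)"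
proof -
  define g where "g t = std_normal_density t * f \<bar>t\<bar>" for t
  have gi: "integrable lborel g"
    using int by (simp add: g_def[abs_def] integrable_density)
  have even: "g (- t) = g t" for t by (simp add: g_def std_normal_density_def)
  have i1: "integrable lborel (\<lambda>t. indicator {0..} t * g t)" "integrable lborel (\<lambda>t. indicator {..0} t * g t)"
    by (rule Bochner_Integration.integrable_bound[OF gi]; use gi in \<open>auto simp: indicator_def\<close>)+
  have refl: "(\<integral>t. indicator {..0} t * g t \<partial>lborel) = (\<integral>t. indicator {0..} t * g t \<partial>lborel)"
    by (subst lborel_integral_real_affine[where c="-1" and t=0]) (auto simp: even indicator_def)
  have "(\<integral>t. f \<bar>t\<bar> \<partial>std_normal_distribution) = (\<integral>t. g t \<partial>lborel)"
    by (simp add: integral_density g_def)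
  \<comment> \<open>The two half-lines overlap only in the origin, a null set.\<close>
  also have "\<dots> = (\<integral>t. indicator {0..} t * g t + indicator {..0} t * g t \<partial>lborel)"
    using AE_lborel_singleton[of "0::real"] gi i1
    by (intro integral_cong_AE) (auto elim!: eventually_mono simp: indicator_def)
  also have "\<dots> = 2 * (\<integral>t. indicator {0..} t * g t \<partial>lborel)"
    using i1 refl by simp
  finally have eq: "(\<integral>t. f \<bar>t\<bar> \<partial>std_normal_distribution) = 2 * (\<integral>t. indicator {0..} t * g t \<partial>lborel)" .
  have "kernel_phi u * f u = 2 * (indicator {0..} u * g u)" for u
    by (simp add: kernel_phi_eq g_def indicator_def)
  then show ?thesis
    using i1 eq by (simp add: has_bochner_integral_iff)
qed

lemma has_bochner_integral_kernel_phi_excess: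
  assumes "0 \<le> \<tau>"
  shows "has_bochner_integral lborel (\<lambda>u. kernel_phi u * (max (u - \<tau>) 0) ^ k) (excess k \<tau>)"
  unfolding excess_def using assms
  by (intro has_bochner_integral_kernel_phi[of "\<lambda>u. (max (u - \<tau>) 0) ^ k"]) auto

lemma prob_space_kernel_phi: "prob_space (density lborel (\<lambda>u. ennreal (kernel_phi u)))"
proof
  have nn: "0 \<le> kernel_phi u" for u by (simp add: kernel_phi_def)
  have "has_bochner_integral lborel kernel_phi 1"
    using has_bochner_integral_kernel_phi[of "\<lambda>_. 1"] std_normal.prob_space by simp
  then show "emeasure (density lborel (\<lambda>u. ennreal (kernel_phi u))) (space (density lborel (\<lambda>u. ennreal (kernel_phi u)))) = 1"
    using nn by (simp add: emeasure_density nn_integral_eq_integral has_bochner_integral_iff)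
qed

text \<open>Integrating the derivative of \<open>(u - \<tau>)\<^sup>2 * exp (- u\<^sup>2 / 2)\<close> over \<open>[\<tau>, \<infinity>)\<close> gives
  \<open>\<integral> u * (u - \<tau>)\<^sup>2 = 2 * \<integral> (u - \<tau>)\<close> with respect to the Gaussian weight, and \<open>u \<ge> \<tau>\<close>.\<close>

lemma excess2_le_excess1:
  assumes \<tau>: "0 \<le> \<tau>"
  shows "\<tau> * excess 2 \<tau> \<le> 2 * excess 1 \<tau>"
proof -
  let ?n = std_normal_density
  \<comment> \<open>\<open>f\<close> is the derivative of \<open>F\<close>, and \<open>F\<close>
    vanishes at \<tau> and at infinity, so \<open>f\<close> integrates to zero over the
    half-line.\<close>
  define f where "f u = ?n u * (u * (u - \<tau>)\<^sup>2 - 2 * (u - \<tau>))" for u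
  define F where "F u = - ((u - \<tau>)\<^sup>2 * ?n u)" for u
  have fint: "integrable lborel f"
  proof -
    have "f = (\<lambda>u. ?n u * u ^ 3 - 2 * \<tau> * (?n u * u ^ 2) + (\<tau>\<^sup>2 - 2) * (?n u * u ^ 1) + 2 * \<tau> * (?n u * u ^ 0))"
      by (simp add: f_def fun_eq_iff power2_eq_square power3_eq_cube algebra_simps)
    then show ?thesis
      by (simp only:) (intro Bochner_Integration.integrable_add Bochner_Integration.integrable_diff
          integrable_mult_right integrable_std_normal_moment)
  qed
  define c :: real where "c = 1 / sqrt (2 * pi)"
  have n: "?n = (\<lambda>u. c * exp (- u\<^sup>2 / 2))" by (simp add: fun_eq_iff std_normal_density_def c_def)
  have dF: "(F has_real_derivative f u) (at u)" for u
    unfolding F_def f_def n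
    by (auto intro!: derivative_eq_intros) (simp add: power2_eq_square algebra_simps)
  have "(LBINT u=ereal \<tau>..\<infinity>. f u) = 0 - 0"
  proof (rule interval_integral_FTC_integrable)
    show "ereal \<tau> < \<infinity>" by simp
    show "(F has_vector_derivative f u) (at u)" for u
      using dF by (simp add: has_real_derivative_iff_has_vector_derivative)
    show "isCont f u" for u
      unfolding f_def n by (intro continuous_intros) auto
    show "set_integrable lborel (einterval (ereal \<tau>) \<infinity>) f"
      unfolding set_integrable_def by (rule integrable_mult_indicator[OF _ fint]) simp
    have "(F \<longlongrightarrow> F \<tau>) (at_right \<tau>)"
      using DERIV_isCont[OF dF] by (simp add: isCont_def filterlim_at_split)
    then have "(F \<longlongrightarrow> 0) (at_right \<tau>)" by (simp add: F_def)
    then show "((F \<circ> real_of_ereal) \<longlongrightarrow> 0) (at_right (ereal \<tau>))"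
      by (simp add: ereal_tendsto_simps)
    \<comment> \<open>\<open>F\<close> is squeezed between \<open>- u^2 * exp (- u^2 / 2)\<close>
      and 0; the lower bound is written as a power over an exponential in the variable
      \<open>u^2 / 2\<close>.\<close>
    have "(F \<longlongrightarrow> 0) at_top"
    proof (rule tendsto_sandwich[where f="\<lambda>u. - (2 * ((u\<^sup>2 / 2) ^ 1 / exp (u\<^sup>2 / 2)))" and h="\<lambda>_. 0"])
      have "?n u \<le> exp (- u\<^sup>2 / 2)" for u
      proof -
        have "1 / sqrt (2 * pi) \<le> 1" using pi_ge_two by simp
        then show ?thesis unfolding std_normal_density_def by (intro mult_left_le_one_le) auto
      qed
      then have "(u - \<tau>)\<^sup>2 * ?n u \<le> u\<^sup>2 * exp (- u\<^sup>2 / 2)" if "\<tau> \<le> u" for u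
        using that \<tau> by (intro mult_mono power_mono) auto
      moreover have "2 * ((u\<^sup>2 / 2) ^ 1 / exp (u\<^sup>2 / 2)) = u\<^sup>2 * exp (- u\<^sup>2 / 2)" for u :: real
        by (simp add: exp_minus inverse_eq_divide)
      ultimately have "- (2 * ((u\<^sup>2 / 2) ^ 1 / exp (u\<^sup>2 / 2))) \<le> F u" if "\<tau> \<le> u" for u
        unfolding F_def using that by (simp only: neg_le_iff_le)
      then show "eventually (\<lambda>u. - (2 * ((u\<^sup>2 / 2) ^ 1 / exp (u\<^sup>2 / 2))) \<le> F u) at_top"
        by (intro eventually_at_top_linorderI)
      have "filterlim (\<lambda>u::real. (1 / 2) * u\<^sup>2) at_top at_top"
        by (intro filterlim_tendsto_pos_mult_at_top[OF tendsto_const] filterlim_pow_at_top filterlim_ident) auto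
      then have "filterlim (\<lambda>u::real. u\<^sup>2 / 2) at_top at_top" by simp
      then have "((\<lambda>u::real. (u\<^sup>2 / 2) ^ 1 / exp (u\<^sup>2 / 2)) \<longlongrightarrow> 0) at_top"
        by (rule filterlim_compose[OF tendsto_power_div_exp_0[of 1]])
      from tendsto_minus[OF tendsto_mult_right_zero[OF this, of 2]]
      show "((\<lambda>u::real. - (2 * ((u\<^sup>2 / 2) ^ 1 / exp (u\<^sup>2 / 2)))) \<longlongrightarrow> 0) at_top" by simp
    qed (auto simp: F_def)
    then show "((F \<circ> real_of_ereal) \<longlongrightarrow> 0) (at_left \<infinity>)"
      by (simp add: ereal_tendsto_simps)
  qed
  then have zero: "(\<integral>u. indicator {\<tau><..} u * f u \<partial>lborel) = 0"
    unfolding interval_lebesgue_integral_def set_lebesgue_integral_def by simp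
  have e1: "has_bochner_integral lborel (\<lambda>u. 2 * (kernel_phi u * (max (u - \<tau>) 0) ^ 1)) (2 * excess 1 \<tau>)"
    and e2: "has_bochner_integral lborel (\<lambda>u. \<tau> * (kernel_phi u * (max (u - \<tau>) 0) ^ 2)) (\<tau> * excess 2 \<tau>)"
    by (intro has_bochner_integral_mult_right has_bochner_integral_kernel_phi_excess[OF \<tau>])+
  have "\<tau> * excess 2 \<tau> - 2 * excess 1 \<tau>
      = (\<integral>u. \<tau> * (kernel_phi u * (max (u - \<tau>) 0) ^ 2) - 2 * (kernel_phi u * (max (u - \<tau>) 0) ^ 1) \<partial>lborel)"
    using has_bochner_integral_diff[OF e2 e1] by (simp only: has_bochner_integral_iff)
  \<comment> \<open>The outer factor 2 comes from folding the normal density. The two integrands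
    differ only by \<tau> in place of \<open>u\<close> in front of the square, and
    \<open>\<tau> < u\<close> on the domain.\<close>
  also have "\<dots> \<le> (\<integral>u. 2 * (indicator {\<tau><..} u * f u) \<partial>lborel)"
  proof (rule integral_mono)
    show "integrable lborel (\<lambda>u. \<tau> * (kernel_phi u * (max (u - \<tau>) 0) ^ 2) - 2 * (kernel_phi u * (max (u - \<tau>) 0) ^ 1))"
      using has_bochner_integral_diff[OF e2 e1] by (simp only: has_bochner_integral_iff)
    show "integrable lborel (\<lambda>u. 2 * (indicator {\<tau><..} u * f u))"
      by (intro integrable_mult_right, rule Bochner_Integration.integrable_bound[OF fint])
        (use fint in \<open>auto simp: indicator_def\<close>)
    show "\<tau> * (kernel_phi u * (max (u - \<tau>) 0) ^ 2) - 2 * (kernel_phi u * (max (u - \<tau>) 0) ^ 1)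
        \<le> 2 * (indicator {\<tau><..} u * f u)" for u
    proof (cases "\<tau> < u")
      case True
      have "(\<tau> - u) * (2 * ?n u * (u - \<tau>)\<^sup>2) \<le> 0"
        using True by (intro mult_nonpos_nonneg) auto
      then show ?thesis
        using True \<tau> by (simp add: kernel_phi_eq f_def algebra_simps)
    qed simp
  qed
  also have "\<dots> = 0" using zero by simp
  finally show ?thesis by simp
qed

section \<open>The function \<open>psi\<close> and its minimiser\<close>

lemma psi_objective_excess:
  assumes "0 \<le> \<tau>"
  shows "psi_objective \<rho> \<tau> = \<rho> * (1 + \<tau>\<^sup>2) + (1 - \<rho>) * excess 2 \<tau>"
proof -
  have "(LINT u:{\<tau>..}|lborel. (u - \<tau>)\<^sup>2 * kernel_phi u) = (\<integral>u. kernel_phi u * (max (u - \<tau>) 0) ^ 2 \<partial>lborel)"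
    unfolding set_lebesgue_integral_def
    by (intro Bochner_Integration.integral_cong refl) (auto simp: indicator_def max_def)
  then show ?thesis
    using has_bochner_integral_kernel_phi_excess[OF assms, of 2]
    by (simp add: psi_objective_def has_bochner_integral_iff)
qed

text \<open>With denominators cleared, stationarity says that the derivative
  \<open>2 * (\<rho> * \<tau> - (1 - \<rho>) * excess 1 \<tau>)\<close> of the objective vanishes.
  This form stays meaningful at \<open>\<tau> = 0\<close>, the critical point for
  \<open>\<rho> = 1\<close>.\<close>

lemma stationary_iff_excess:
  assumes "0 < \<tau>" "\<rho> < 1"
  shows "stationary \<rho> \<tau> \<longleftrightarrow> (1 - \<rho>) * excess 1 \<tau> = \<rho> * \<tau>"
proof -
  have "(LINT u:{\<tau>..}|lborel. (u / \<tau> - 1) * kernel_phi u)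
      = (\<integral>u. (1 / \<tau>) * (kernel_phi u * (max (u - \<tau>) 0) ^ 1) \<partial>lborel)"
    unfolding set_lebesgue_integral_def using assms
    by (intro Bochner_Integration.integral_cong refl) (auto simp: indicator_def max_def field_simps)
  also have "\<dots> = (1 / \<tau>) * excess 1 \<tau>"
    using has_bochner_integral_mult_right[OF has_bochner_integral_kernel_phi_excess[of \<tau> 1], of "1 / \<tau>"] assms
    by (simp only: has_bochner_integral_iff less_imp_le)
  finally show ?thesis
    using assms by (auto simp: stationary_def field_simps)
qed

lemma psi_le_objective:
  assumes "0 \<le> \<rho>" "\<rho> \<le> 1" "0 \<le> \<tau>"
  shows "psi \<rho> \<le> psi_objective \<rho> \<tau>"
  unfolding psi_def using assms excess_nonneg[of 2]
  by (intro cINF_lower bdd_belowI2[where m=0]) (auto simp: psi_objective_excess)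

lemma psi_range:
  assumes "0 \<le> \<rho>" "\<rho> \<le> 1"
  shows "psi \<rho> \<in> {0..1}"
proof -
  have "0 \<le> psi \<rho>"
    unfolding psi_def using assms excess_nonneg[of 2]
    by (intro cINF_greatest) (auto simp: psi_objective_excess)
  moreover have "psi \<rho> \<le> 1"
    using psi_le_objective[OF assms, of 0] by (simp add: psi_objective_excess excess2_0)
  ultimately show ?thesis by simp
qed

text \<open>At \<open>\<rho> = 0\<close> the objective is \<open>excess 2 \<tau>\<close>, which is
  at most \<open>2 * excess 1 0 / \<tau>\<close>; the chosen \<tau> makes this bound equal to
  \<open>e\<close>.\<close>

lemma psi_0: "psi 0 \<le> 0"
proof (rule field_le_epsilon)
  fix e :: real assume e: "0 < e"
  define \<tau> where "\<tau> = 2 * excess 1 0 / e"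
  have \<tau>: "0 < \<tau>" using e excess1_0 by (simp add: \<tau>_def)
  have "\<tau> * psi 0 \<le> \<tau> * excess 2 \<tau>"
    using psi_le_objective[of 0 \<tau>] \<tau> by (simp add: psi_objective_excess)
  also have "\<dots> \<le> 2 * excess 1 0"
    using excess2_le_excess1[of \<tau>] excess_antimono[of 0 \<tau> 1] \<tau> by simp
  also have "\<dots> = \<tau> * e" using e by (simp add: \<tau>_def)
  finally show "psi 0 \<le> 0 + e" using \<tau> by simp
qed

text \<open>Convexity makes a critical point a global minimum: the linear terms of the tangent
  inequality for \<open>excess 2\<close> and of the expanded quadratic cancel by
  \<open>crit\<close>.\<close>

lemma psi_eq_objective:
  assumes \<rho>: "0 \<le> \<rho>" "\<rho> \<le> 1" and \<tau>: "0 \<le> \<tau>" and crit: "(1 - \<rho>) * excess 1 \<tau> = \<rho> * \<tau>"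
  shows "psi_objective \<rho> \<tau> = psi \<rho>"
proof (rule antisym)
  show "psi \<rho> \<le> psi_objective \<rho> \<tau>" by (rule psi_le_objective[OF \<rho> \<tau>])
  have "psi_objective \<rho> \<tau> \<le> psi_objective \<rho> \<sigma>" if \<sigma>: "0 \<le> \<sigma>" for \<sigma>
  proof -
    have "(1 - \<rho>) * (excess 2 \<tau> - 2 * excess 1 \<tau> * (\<sigma> - \<tau>)) \<le> (1 - \<rho>) * excess 2 \<sigma>"
      using excess2_tangent[OF \<sigma> \<tau>] \<rho> by (intro mult_left_mono) auto
    moreover have "(1 - \<rho>) * (excess 2 \<tau> - 2 * excess 1 \<tau> * (\<sigma> - \<tau>))
        = (1 - \<rho>) * excess 2 \<tau> - 2 * ((1 - \<rho>) * excess 1 \<tau>) * (\<sigma> - \<tau>)"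
      by (simp add: algebra_simps)
    moreover have "\<rho> * (1 + \<sigma>\<^sup>2) = \<rho> * (1 + \<tau>\<^sup>2) + 2 * (\<rho> * \<tau>) * (\<sigma> - \<tau>) + \<rho> * (\<sigma> - \<tau>)\<^sup>2"
      by (simp add: power2_eq_square algebra_simps)
    moreover have "0 \<le> \<rho> * (\<sigma> - \<tau>)\<^sup>2" using \<rho> by simp
    ultimately show ?thesis
      unfolding psi_objective_excess[OF \<sigma>] psi_objective_excess[OF \<tau>] crit by linarith
  qed
  then show "psi_objective \<rho> \<tau> \<le> psi \<rho>"
    unfolding psi_def by (intro cINF_greatest) auto
qed

lemma ex_critical:
  assumes "0 < \<rho>" "\<rho> \<le> 1"
  shows "\<exists>\<tau>\<ge>0. (1 - \<rho>) * excess 1 \<tau> = \<rho> * \<tau>"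
proof -
  \<comment> \<open>\<open>\<rho> * b\<close> equals the value of the other side at 0, which
    dominates its value at \<open>b\<close>; hence the difference changes sign on
    \<open>{0..b}\<close>.\<close>
  define b where "b = (1 - \<rho>) * excess 1 0 / \<rho>"
  have b: "0 \<le> b" using assms excess_nonneg by (auto simp: b_def)
  have "(1 - \<rho>) * excess 1 b \<le> (1 - \<rho>) * excess 1 0"
    using assms excess_antimono[of 0 b 1] b by (intro mult_left_mono) auto
  also have "\<dots> = \<rho> * b" using assms by (simp add: b_def)
  finally have "0 \<le> \<rho> * b - (1 - \<rho>) * excess 1 b" by simp
  moreover have "\<rho> * 0 - (1 - \<rho>) * excess 1 0 \<le> 0" using assms excess_nonneg by auto
  moreover have "continuous_on {0..b} (\<lambda>\<tau>. \<rho> * \<tau> - (1 - \<rho>) * excess 1 \<tau>)"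
    by (intro continuous_intros continuous_on_subset[OF continuous_on_excess1]) auto
  ultimately obtain \<tau> where "0 \<le> \<tau>" "\<rho> * \<tau> - (1 - \<rho>) * excess 1 \<tau> = 0"
    using IVT'[of "\<lambda>\<tau>. \<rho> * \<tau> - (1 - \<rho>) * excess 1 \<tau>" 0 0 b] b by auto
  then show ?thesis by (intro exI[of _ \<tau>]) auto
qed

text \<open>In the cleared equation one side is nonincreasing in \<tau> and the other strictly
  increasing; the root is not 0 because \<open>excess 1 0\<close> is positive.\<close>

lemma ex1_stationary:
  assumes "0 < \<rho>" "\<rho> < 1"
  shows "\<exists>!\<tau>. 0 < \<tau> \<and> stationary \<rho> \<tau>"
proof -
  obtain \<tau> where \<tau>: "0 \<le> \<tau>" "(1 - \<rho>) * excess 1 \<tau> = \<rho> * \<tau>"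
    using ex_critical[of \<rho>] assms by auto
  have "\<tau> \<noteq> 0" using \<tau> assms excess1_0 by auto
  then have "0 < \<tau> \<and> stationary \<rho> \<tau>" using \<tau> assms by (simp add: stationary_iff_excess)
  moreover have False if "0 < a" "a < b" "stationary \<rho> a" "stationary \<rho> b" for a b
  proof -
    have "(1 - \<rho>) * excess 1 b \<le> (1 - \<rho>) * excess 1 a"
      using that assms by (intro mult_left_mono excess_antimono) auto
    moreover have "(1 - \<rho>) * excess 1 a = \<rho> * a" "(1 - \<rho>) * excess 1 b = \<rho> * b"
      using that assms by (auto simp: stationary_iff_excess)
    ultimately have "\<rho> * b \<le> \<rho> * a" by linarith
    then show False using that assms by simp
  qed
  ultimately show ?thesis by (metis linorder_neqE)
qed

text \<open>Second moment as variance plus squared mean, where independence of the coordinates makes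
  the variances add.\<close>

lemma has_bochner_integral_std_normal_vector_sum_sq:
  fixes f :: "'n::finite \<Rightarrow> real \<Rightarrow> real"
  assumes f: "\<And>i. integrable std_normal_distribution (f i)"
    and f2: "\<And>i. integrable std_normal_distribution (\<lambda>t. (f i t)\<^sup>2)"
  shows "has_bochner_integral std_normal_vector (\<lambda>g :: real ^ 'n. (\<Sum>i\<in>UNIV. f i (g $ i))\<^sup>2)
    ((\<Sum>i\<in>UNIV. integral\<^sup>L std_normal_distribution (\<lambda>t. (f i t)\<^sup>2) - (integral\<^sup>L std_normal_distribution (f i))\<^sup>2)
       + (\<Sum>i\<in>UNIV. integral\<^sup>L std_normal_distribution (f i))\<^sup>2)"
proof -
  let ?m = "\<lambda>i. integral\<^sup>L std_normal_distribution (f i)"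
    and ?v = "\<lambda>i. integral\<^sup>L std_normal_distribution (\<lambda>t. (f i t)\<^sup>2)"
  have ax: "axis i 1 \<in> (Basis :: (real ^ 'n) set)" for i by (simp add: axis_in_Basis_iff)
  have "has_bochner_integral std_normal_vector (\<lambda>g :: real ^ 'n. f i (g $ i) * f j (g $ j))
      (?m i * ?m j + (if i = j then ?v i - (?m i)\<^sup>2 else 0))" for i j
  proof (cases "i = j")
    case True
    then show ?thesis
      using has_bochner_integral_std_normal_vector_coord[OF ax f2[of i]]
      by (simp add: inner_axis power2_eq_square)
  next
    case False
    then show ?thesis
      using has_bochner_integral_std_normal_vector_coord2[OF ax[of i] ax[of j] _ f[of i] f[of j]]
      by (simp add: inner_axis axis_eq_axis)
  qed
  then have "has_bochner_integral std_normal_vector (\<lambda>g :: real ^ 'n. \<Sum>i\<in>UNIV. \<Sum>j\<in>UNIV. f i (g $ i) * f j (g $ j))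
      (\<Sum>i\<in>UNIV. \<Sum>j\<in>UNIV. ?m i * ?m j + (if i = j then ?v i - (?m i)\<^sup>2 else 0))"
    by (intro has_bochner_integral_sum)
  moreover have "(\<Sum>i\<in>UNIV. \<Sum>j\<in>UNIV. ?m i * ?m j + (if i = j then ?v i - (?m i)\<^sup>2 else 0))
      = (\<Sum>i\<in>UNIV. ?v i - (?m i)\<^sup>2) + (\<Sum>i\<in>UNIV. ?m i)\<^sup>2"
    by (simp add: sum.distrib power2_eq_square[of "sum _ _"] sum_product)
  ultimately show ?thesis
    by (simp add: power2_eq_square[of "sum _ _"] sum_product)
qed

subsection \<open>The descent cone of the \<open>\<ell>\<^sub>1\<close> norm\<close>

text \<open>The one-sided directional derivative of the norm at \<open>x\<close> in direction
  \<open>y\<close>.\<close>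

definition l1_deriv :: "real ^ 'n \<Rightarrow> real ^ 'n \<Rightarrow> real" where
  "l1_deriv x y = (\<Sum>i\<in>UNIV. if x $ i \<noteq> 0 then sgn (x $ i) * y $ i else \<bar>y $ i\<bar>)"

text \<open>The norm is convex and piecewise linear: it lies above its first-order expansion at
  \<open>x\<close> and agrees with it for short steps.\<close>

lemma descent_cone_l1_norm: "descent_cone l1_norm x = {y. l1_deriv x y \<le> 0}"
proof (intro set_eqI iffI)
  fix y assume "y \<in> descent_cone l1_norm x"
  then obtain \<tau> where \<tau>: "0 < \<tau>" "l1_norm (x + \<tau> *\<^sub>R y) \<le> l1_norm x"
    by (auto simp: descent_cone_def)
  have "l1_norm x + \<tau> * l1_deriv x y \<le> l1_norm (x + \<tau> *\<^sub>R y)"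
    unfolding l1_norm_def l1_deriv_def sum_distrib_left sum.distrib[symmetric]
    using \<tau>(1) by (intro sum_mono) (auto simp: sgn_real_def abs_mult)
  then have "\<tau> * l1_deriv x y \<le> 0" using \<tau>(2) by linarith
  then show "y \<in> {y. l1_deriv x y \<le> 0}" using \<tau>(1) by (simp add: mult_le_0_iff)
next
  fix y assume y: "y \<in> {y. l1_deriv x y \<le> 0}"
  \<comment> \<open>A step so short that no nonzero entry of \<open>x\<close> changes sign. The
    summand 1 in the denominator avoids division by zero, and the inserted 1 keeps the set nonempty
    when \<open>x = 0\<close>.\<close>
  define \<tau> where "\<tau> = Min (insert 1 ((\<lambda>i. \<bar>x $ i\<bar> / (\<bar>y $ i\<bar> + 1)) ` {i. x $ i \<noteq> 0}))"
  have \<tau>: "0 < \<tau>" unfolding \<tau>_def by (subst Min_gr_iff) (auto intro!: divide_pos_pos)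
  have small: "\<tau> * \<bar>y $ i\<bar> \<le> \<bar>x $ i\<bar>" if "x $ i \<noteq> 0" for i
  proof -
    have "\<tau> \<le> \<bar>x $ i\<bar> / (\<bar>y $ i\<bar> + 1)"
      unfolding \<tau>_def using that by (intro Min_le) auto
    then have "\<tau> * (\<bar>y $ i\<bar> + 1) \<le> \<bar>x $ i\<bar>" by (simp add: pos_le_divide_eq)
    then show ?thesis using \<tau> by (simp add: algebra_simps)
  qed
  have "l1_norm (x + \<tau> *\<^sub>R y) = l1_norm x + \<tau> * l1_deriv x y"
    unfolding l1_norm_def l1_deriv_def sum_distrib_left sum.distrib[symmetric]
  proof (intro sum.cong refl)
    fix i
    show "\<bar>(x + \<tau> *\<^sub>R y) $ i\<bar> = \<bar>x $ i\<bar> + \<tau> * (if x $ i \<noteq> 0 then sgn (x $ i) * y $ i else \<bar>y $ i\<bar>)"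
    proof (cases "x $ i = 0")
      case False
      have "\<bar>\<tau> * y $ i\<bar> \<le> \<bar>x $ i\<bar>" using small[OF False] \<tau> by (simp add: abs_mult)
      then show ?thesis using False by (auto simp: sgn_real_def)
    qed (use \<tau> in \<open>simp add: abs_mult\<close>)
  qed
  also have "\<dots> \<le> l1_norm x" using \<tau> y by (simp add: mult_le_0_iff)
  finally show "y \<in> descent_cone l1_norm x" using \<tau> by (auto simp: descent_cone_def)
qed

text \<open>\<open>l1_deriv x\<close> is the maximum of the finitely many linear functionals
  \<open>a T\<close>, one for each choice of signs off the support of \<open>x\<close>; the sign
  pattern of \<open>y\<close> attains it.\<close>

lemma polyhedral_cone_descent_cone_l1_norm: "polyhedral_cone (descent_cone l1_norm (x :: real ^ 'n))"
proof -
  define a :: "'n set \<Rightarrow> real ^ 'n" where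
    "a T = (\<chi> i. if x $ i \<noteq> 0 then sgn (x $ i) else if i \<in> T then 1 else - 1)" for T
  have "{y. l1_deriv x y \<le> 0} = (\<Inter>T. {y. a T \<bullet> y \<le> 0})"
  proof (intro set_eqI iffI)
    fix y assume y: "y \<in> {y. l1_deriv x y \<le> 0}"
    have "a T \<bullet> y \<le> l1_deriv x y" for T
      unfolding inner_vec_def l1_deriv_def by (intro sum_mono) (auto simp: a_def)
    then show "y \<in> (\<Inter>T. {y. a T \<bullet> y \<le> 0})" using y order_trans by auto
  next
    fix y assume "y \<in> (\<Inter>T. {y. a T \<bullet> y \<le> 0})"
    then have "a {i. 0 \<le> y $ i} \<bullet> y \<le> 0" by auto
    also have "a {i. 0 \<le> y $ i} \<bullet> y = l1_deriv x y"
      unfolding inner_vec_def l1_deriv_def by (intro sum.cong) (auto simp: a_def)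
    finally show "y \<in> {y. l1_deriv x y \<le> 0}" by simp
  qed
  moreover have "polyhedron (\<Inter>T. {y. a T \<bullet> y \<le> 0})"
    by (intro polyhedron_Inter) (auto simp: polyhedron_halfspace_le)
  moreover have "convex_cone (\<Inter>T. {y. a T \<bullet> y \<le> 0})"
    by (auto simp: convex_cone_iff inner_add_right mult_nonneg_nonpos intro: add_nonpos_nonpos)
  ultimately show ?thesis by (simp add: polyhedral_cone_def descent_cone_l1_norm)
qed

text \<open>The difference of \<open>g\<close> and its nearest point in \<open>\<tau>\<close> times the subdifferential of the norm at \<open>x\<close>.\<close>

definition l1_residual :: "real ^ 'n \<Rightarrow> real \<Rightarrow> real ^ 'n \<Rightarrow> real ^ 'n" where
  "l1_residual x \<tau> g = (\<chi> i. if x $ i \<noteq> 0 then g $ i - \<tau> * sgn (x $ i)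
                              else sgn (g $ i) * max (\<bar>g $ i\<bar> - \<tau>) 0)"

section \<open>Duality between residuals and the projection onto the descent cone\<close>

context
  fixes x :: "real ^ 'n" and \<tau> :: real and g :: "real ^ 'n"
  assumes \<tau>: "0 \<le> \<tau>"
begin

lemma norm_l1_residual:
  "(norm (l1_residual x \<tau> g))\<^sup>2
     = (\<Sum>i\<in>UNIV. if x $ i \<noteq> 0 then (sgn (x $ i) * g $ i - \<tau>)\<^sup>2 else (max (\<bar>g $ i\<bar> - \<tau>) 0)\<^sup>2)"
  unfolding power2_norm_eq_inner inner_vec_def
proof (intro sum.cong refl)
  fix i
  have "(g $ i - \<tau> * sgn (x $ i)) * (g $ i - \<tau> * sgn (x $ i)) = (sgn (x $ i) * g $ i - \<tau>)\<^sup>2" if "x $ i \<noteq> 0"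
    using that by (auto simp: sgn_real_def power2_eq_square algebra_simps)
  moreover have "(sgn (g $ i) * max (\<bar>g $ i\<bar> - \<tau>) 0) * (sgn (g $ i) * max (\<bar>g $ i\<bar> - \<tau>) 0) = (max (\<bar>g $ i\<bar> - \<tau>) 0)\<^sup>2"
    using \<tau> by (cases "g $ i = 0") (auto simp: power2_eq_square sgn_real_def)
  ultimately show "l1_residual x \<tau> g $ i \<bullet> l1_residual x \<tau> g $ i
      = (if x $ i \<noteq> 0 then (sgn (x $ i) * g $ i - \<tau>)\<^sup>2 else (max (\<bar>g $ i\<bar> - \<tau>) 0)\<^sup>2)"
    by (simp add: l1_residual_def)
qed

lemma l1_deriv_residual:
  "l1_deriv x (l1_residual x \<tau> g)
     = (\<Sum>i\<in>UNIV. if x $ i \<noteq> 0 then sgn (x $ i) * g $ i - \<tau> else max (\<bar>g $ i\<bar> - \<tau>) 0)"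
  unfolding l1_deriv_def l1_residual_def
  using \<tau> by (intro sum.cong refl) (auto simp: sgn_real_def abs_mult)

text \<open>\<open>g - l1_residual x \<tau> g\<close> lies in \<tau> times the subdifferential: its
  entries are \<open>\<tau> * sgn (x $ i)\<close> on the support and at most \<tau> in modulus off
  it.\<close>

lemma inner_l1_residual_le: "(g - l1_residual x \<tau> g) \<bullet> c \<le> \<tau> * l1_deriv x c"
  unfolding inner_vec_def l1_deriv_def sum_distrib_left
proof (intro sum_mono)
  fix i
  show "(g - l1_residual x \<tau> g) $ i \<bullet> c $ i \<le> \<tau> * (if x $ i \<noteq> 0 then sgn (x $ i) * c $ i else \<bar>c $ i\<bar>)"
  proof (cases "x $ i = 0")
    case True
    have "\<bar>(g - l1_residual x \<tau> g) $ i\<bar> \<le> \<tau>"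
      using True \<tau> by (auto simp: l1_residual_def sgn_real_def)
    then have "\<bar>(g - l1_residual x \<tau> g) $ i\<bar> * \<bar>c $ i\<bar> \<le> \<tau> * \<bar>c $ i\<bar>"
      by (intro mult_right_mono) auto
    then show ?thesis using True abs_ge_self[of "(g - l1_residual x \<tau> g) $ i * c $ i"] by (simp add: abs_mult)
  qed (simp add: l1_residual_def)
qed

text \<open>Complementary slackness: off the support, wherever the residual is nonzero,
  \<open>g\<close> minus the residual is \<tau> times the sign of the residual.\<close>

lemma inner_l1_residual_self:
  "(g - l1_residual x \<tau> g) \<bullet> l1_residual x \<tau> g = \<tau> * l1_deriv x (l1_residual x \<tau> g)"
  unfolding inner_vec_def l1_deriv_def sum_distrib_left
  using \<tau> by (intro sum.cong refl) (auto simp: l1_residual_def sgn_real_def max_def abs_mult)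

text \<open>Weak duality: the squared norm of the projection \<open>?p\<close> equals
  \<open>g \<bullet> ?p\<close>, and splitting \<open>g\<close> at the residual leaves a
  Cauchy-Schwarz term and a term that is nonpositive on the cone.\<close>

lemma norm_closest_point_le_l1_residual:
  "(norm (closest_point (descent_cone l1_norm x) g))\<^sup>2 \<le> (norm (l1_residual x \<tau> g))\<^sup>2"
proof -
  let ?D = "descent_cone l1_norm x" and ?y = "l1_residual x \<tau> g"
  let ?p = "closest_point ?D g"
  have D: "closed ?D" "convex_cone ?D"
    using polyhedral_cone_descent_cone_l1_norm[of x] polyhedron_imp_closed by (auto simp: polyhedral_cone_def)
  have p: "l1_deriv x ?p \<le> 0"
    using closest_point_convex_cone(1)[OF D, of g] by (simp add: descent_cone_l1_norm)
  have "norm ?p * norm ?p = g \<bullet> ?p"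
    using closest_point_convex_cone(2)[OF D, of g] by (simp add: inner_diff_left dot_square_norm power2_eq_square)
  also have "\<dots> = ?y \<bullet> ?p + (g - ?y) \<bullet> ?p" by (simp add: inner_diff_left)
  also have "\<dots> \<le> norm ?y * norm ?p + \<tau> * l1_deriv x ?p"
    by (intro add_mono norm_cauchy_schwarz inner_l1_residual_le)
  also have "\<dots> \<le> norm ?y * norm ?p" using p \<tau> by (simp add: mult_nonneg_nonpos)
  finally have "norm ?p \<le> norm ?y" by (cases "?p = 0") (auto dest: mult_right_le_imp_le)
  then show ?thesis by (intro power_mono) auto
qed

end

text \<open>Strong duality: with \<open>h \<tau>\<close> the derivative at the residual,
  \<open>h \<tau> \<le> 0\<close> and \<open>\<tau> * h \<tau> = 0\<close> are Moreau's conditions.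
  Either \<open>\<tau> = 0\<close> satisfies them or \<open>h\<close> has a root.\<close>

lemma ex_closest_point_eq_l1_residual:
  fixes x g :: "real ^ 'n"
  assumes "x \<noteq> 0"
  shows "\<exists>\<tau>\<ge>0. closest_point (descent_cone l1_norm x) g = l1_residual x \<tau> g"
proof -
  let ?D = "descent_cone l1_norm x"
  have D: "closed ?D" "convex_cone ?D"
    using polyhedral_cone_descent_cone_l1_norm[of x] polyhedron_imp_closed by (auto simp: polyhedral_cone_def)
  define h where "h \<tau> = (\<Sum>i\<in>UNIV. if x $ i \<noteq> 0 then sgn (x $ i) * g $ i - \<tau> else max (\<bar>g $ i\<bar> - \<tau>) 0)" for \<tau>
  have "\<exists>\<tau>\<ge>0. h \<tau> \<le> 0 \<and> \<tau> * h \<tau> = 0"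
  proof (cases "h 0 \<le> 0")
    case False
    \<comment> \<open>A bound for all entries of \<open>g\<close>, so every summand of
      \<open>h b\<close> is nonpositive.\<close>
    define b where "b = (\<Sum>i\<in>UNIV. \<bar>g $ i\<bar>)"
    have b: "0 \<le> b" unfolding b_def by (intro sum_nonneg) auto
    have gb: "\<bar>g $ i\<bar> \<le> b" for i unfolding b_def by (intro member_le_sum) auto
    have "h b \<le> 0"
      unfolding h_def
    proof (intro sum_nonpos)
      fix i
      show "(if x $ i \<noteq> 0 then sgn (x $ i) * g $ i - b else max (\<bar>g $ i\<bar> - b) 0) \<le> 0"
        using gb[of i] by (auto simp: sgn_real_def)
    qed
    moreover have "continuous_on {0..b} h"
    proof -
      have "continuous_on {0..b} (\<lambda>\<tau>. if x $ i \<noteq> 0 then sgn (x $ i) * g $ i - \<tau> else max (\<bar>g $ i\<bar> - \<tau>) 0)" for i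
        by (cases "x $ i = 0") (auto intro!: continuous_intros)
      then show ?thesis unfolding h_def[abs_def] by (intro continuous_on_sum)
    qed
    ultimately obtain \<tau> where "0 \<le> \<tau>" "h \<tau> = 0"
      using IVT2'[of h b 0 0] False b by auto
    then show ?thesis by auto
  qed auto
  then obtain \<tau> where \<tau>: "0 \<le> \<tau>" "h \<tau> \<le> 0" "\<tau> * h \<tau> = 0" by blast
  have h: "l1_deriv x (l1_residual x \<tau> g) = h \<tau>"
    by (simp add: l1_deriv_residual[OF \<tau>(1)] h_def)
  have "closest_point ?D g = l1_residual x \<tau> g"
  proof (rule closest_point_convex_coneI[OF D])
    show "l1_residual x \<tau> g \<in> ?D" using \<tau> h by (simp add: descent_cone_l1_norm)
    show "(g - l1_residual x \<tau> g) \<bullet> l1_residual x \<tau> g = 0"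
      using \<tau> h by (simp add: inner_l1_residual_self)
    fix c assume "c \<in> ?D"
    then have "\<tau> * l1_deriv x c \<le> 0" using \<tau>(1) by (simp add: descent_cone_l1_norm mult_nonneg_nonpos)
    then show "(g - l1_residual x \<tau> g) \<bullet> c \<le> 0" using inner_l1_residual_le[OF \<tau>(1), of g x c] by linarith
  qed
  then show ?thesis using \<tau>(1) by blast
qed

text \<open>As a function of \<open>\<tau>\<close>, the squared norm of the residual minus \<open>s * \<tau>\<^sup>2\<close> is convex, and
  the derivative of the squared norm is \<open>-2\<close> times the directional derivative at the residual; now complete the square.\<close>

lemma norm_l1_residual_strongly_convex:
  fixes x g :: "real ^ 'n"
  assumes s: "s = card {i. x $ i \<noteq> 0}" "0 < s" and \<sigma>: "0 \<le> \<sigma>" and \<tau>: "0 \<le> \<tau>"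
  shows "(norm (l1_residual x \<tau> g))\<^sup>2 - (l1_deriv x (l1_residual x \<tau> g))\<^sup>2 / real s
       \<le> (norm (l1_residual x \<sigma> g))\<^sup>2"
proof -
  let ?h = "l1_deriv x (l1_residual x \<tau> g)"
  have "(norm (l1_residual x \<tau> g))\<^sup>2 - 2 * (\<sigma> - \<tau>) * ?h + real s * (\<sigma> - \<tau>)\<^sup>2
      = (\<Sum>i\<in>UNIV. (if x $ i \<noteq> 0 then (sgn (x $ i) * g $ i - \<tau>)\<^sup>2 else (max (\<bar>g $ i\<bar> - \<tau>) 0)\<^sup>2)
           - 2 * (\<sigma> - \<tau>) * (if x $ i \<noteq> 0 then sgn (x $ i) * g $ i - \<tau> else max (\<bar>g $ i\<bar> - \<tau>) 0)
           + (if x $ i \<noteq> 0 then (\<sigma> - \<tau>)\<^sup>2 else 0))"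
    unfolding norm_l1_residual[OF \<tau>] l1_deriv_residual[OF \<tau>] sum.distrib sum_subtractf sum_distrib_left[symmetric]
    by (simp add: s(1) sum.If_cases)
  \<comment> \<open>On the support the expansion is exact, and its quadratic terms supply the factor
    \<open>s\<close>; off the support it is the tangent inequality.\<close>
  also have "\<dots> \<le> (norm (l1_residual x \<sigma> g))\<^sup>2"
    unfolding norm_l1_residual[OF \<sigma>]
  proof (intro sum_mono)
    fix i
    show "(if x $ i \<noteq> 0 then (sgn (x $ i) * g $ i - \<tau>)\<^sup>2 else (max (\<bar>g $ i\<bar> - \<tau>) 0)\<^sup>2)
           - 2 * (\<sigma> - \<tau>) * (if x $ i \<noteq> 0 then sgn (x $ i) * g $ i - \<tau> else max (\<bar>g $ i\<bar> - \<tau>) 0)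
           + (if x $ i \<noteq> 0 then (\<sigma> - \<tau>)\<^sup>2 else 0)
        \<le> (if x $ i \<noteq> 0 then (sgn (x $ i) * g $ i - \<sigma>)\<^sup>2 else (max (\<bar>g $ i\<bar> - \<sigma>) 0)\<^sup>2)"
      using pos_part_sq_tangent[of "\<bar>g $ i\<bar>" \<tau> \<sigma>] by (simp add: power2_eq_square algebra_simps)
  qed
  finally have "(norm (l1_residual x \<tau> g))\<^sup>2 - 2 * (\<sigma> - \<tau>) * ?h + real s * (\<sigma> - \<tau>)\<^sup>2
      \<le> (norm (l1_residual x \<sigma> g))\<^sup>2" .
  moreover have "(norm (l1_residual x \<tau> g))\<^sup>2 - 2 * (\<sigma> - \<tau>) * ?h + real s * (\<sigma> - \<tau>)\<^sup>2
      = (norm (l1_residual x \<tau> g))\<^sup>2 - ?h\<^sup>2 / real s + real s * (\<sigma> - \<tau> - ?h / real s)\<^sup>2"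
    using s(2) by (simp add: power2_eq_square field_simps)
  moreover have "0 \<le> real s * (\<sigma> - \<tau> - ?h / real s)\<^sup>2" by simp
  ultimately show ?thesis by linarith
qed

section \<open>Expectations of the residual and the two bounds\<close>

context
  fixes x :: "real ^ 'n" and s d :: nat
  assumes d: "d = CARD('n)" and s: "s = card {i. x $ i \<noteq> 0}"
begin

lemma sum_support_if:
  "(\<Sum>i\<in>UNIV. if x $ i \<noteq> 0 then a else b) = real s * a + (real d - real s) * b" for a b :: real
proof -
  have "card {i. x $ i = 0} + s = d"
    unfolding s d by (subst card_Un_disjoint[symmetric]) (auto intro!: arg_cong[where f=card])
  then have "real (card {i. x $ i = 0}) = real d - real s" by linarith
  then show ?thesis by (simp add: sum.If_cases s Collect_neg_eq[symmetric])
qed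

text \<open>Both quantities are sums of functions of single coordinates. In the second part the
  variance \<open>v\<close> is kept apart from the squared mean, which vanishes at the critical
  \<tau>.\<close>

lemma expectation_norm_l1_residual:
  assumes \<tau>: "0 \<le> \<tau>"
  shows "has_bochner_integral std_normal_vector (\<lambda>g. (norm (l1_residual x \<tau> g))\<^sup>2)
           (real s * (1 + \<tau>\<^sup>2) + (real d - real s) * excess 2 \<tau>)" (is ?norm)
    and "\<exists>v \<le> real s + (real d - real s) * excess 2 \<tau>.
           has_bochner_integral std_normal_vector (\<lambda>g. (l1_deriv x (l1_residual x \<tau> g))\<^sup>2)
             (v + ((real d - real s) * excess 1 \<tau> - real s * \<tau>)\<^sup>2)" (is ?deriv)
proof -
  let ?E = "integral\<^sup>L std_normal_distribution"
  define f where "f i t = (if x $ i \<noteq> 0 then sgn (x $ i) * t - \<tau> else max (\<bar>t\<bar> - \<tau>) 0)" for i t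
  have const: "has_bochner_integral std_normal_distribution (\<lambda>_. c) c" for c :: real
    using std_normal.prob_space by (simp add: has_bochner_integral_iff)
  have lin: "has_bochner_integral std_normal_distribution (\<lambda>t. c * t - \<tau>) (- \<tau>)" for c
    using has_bochner_integral_diff[OF has_bochner_integral_mult_right[OF has_bochner_integral_std_normal_moment1, of c]
        const[of \<tau>]] by simp
  have sq: "has_bochner_integral std_normal_distribution (\<lambda>t. (c * t - \<tau>)\<^sup>2) (1 + \<tau>\<^sup>2)" if "c\<^sup>2 = 1" for c
  proof -
    have "has_bochner_integral std_normal_distribution (\<lambda>t. c\<^sup>2 * t\<^sup>2 + (- 2 * \<tau> * c) * t + \<tau>\<^sup>2)
        (c\<^sup>2 * 1 + (- 2 * \<tau> * c) * 0 + \<tau>\<^sup>2)"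
      by (intro has_bochner_integral_add has_bochner_integral_mult_right
          has_bochner_integral_std_normal_moment1 has_bochner_integral_std_normal_moment2 const)
    moreover have "c\<^sup>2 * t\<^sup>2 + (- 2 * \<tau> * c) * t + \<tau>\<^sup>2 = (c * t - \<tau>)\<^sup>2" for t
      by (simp add: power2_eq_square algebra_simps)
    ultimately show ?thesis using that by simp
  qed
  have sgn2: "(sgn (x $ i))\<^sup>2 = 1" if "x $ i \<noteq> 0" for i
    using that by (simp add: sgn_real_def)
  have m1: "has_bochner_integral std_normal_distribution (f i) (if x $ i \<noteq> 0 then - \<tau> else excess 1 \<tau>)" for i
    unfolding f_def[abs_def] using lin \<tau> by (auto simp: has_bochner_integral_iff excess_def)
  have m2: "has_bochner_integral std_normal_distribution (\<lambda>t. (f i t)\<^sup>2) (if x $ i \<noteq> 0 then 1 + \<tau>\<^sup>2 else excess 2 \<tau>)" for i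
    unfolding f_def using sq[OF sgn2] \<tau> by (auto simp: has_bochner_integral_iff excess_def)
  have ax: "axis i 1 \<in> (Basis :: (real ^ 'n) set)" for i by (simp add: axis_in_Basis_iff)
  have "has_bochner_integral std_normal_vector (\<lambda>g :: real ^ 'n. \<Sum>i\<in>UNIV. (f i (g $ i))\<^sup>2)
      (\<Sum>i\<in>UNIV. if x $ i \<noteq> 0 then 1 + \<tau>\<^sup>2 else excess 2 \<tau>)"
  proof (intro has_bochner_integral_sum)
    fix i
    show "has_bochner_integral std_normal_vector (\<lambda>g :: real ^ 'n. (f i (g $ i))\<^sup>2)
      (if x $ i \<noteq> 0 then 1 + \<tau>\<^sup>2 else excess 2 \<tau>)"
      using has_bochner_integral_std_normal_vector_coord[OF ax, of "\<lambda>t. (f i t)\<^sup>2" i] m2[of i]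
      by (simp add: inner_axis has_bochner_integral_iff)
  qed
  moreover have "(norm (l1_residual x \<tau> g))\<^sup>2 = (\<Sum>i\<in>UNIV. (f i (g $ i))\<^sup>2)" for g
    unfolding norm_l1_residual[OF \<tau>] by (intro sum.cong) (auto simp: f_def)
  ultimately show ?norm by (simp add: sum_support_if)
  have "has_bochner_integral std_normal_vector (\<lambda>g :: real ^ 'n. (\<Sum>i\<in>UNIV. f i (g $ i))\<^sup>2)
      ((\<Sum>i\<in>UNIV. ?E (\<lambda>t. (f i t)\<^sup>2) - (?E (f i))\<^sup>2) + (\<Sum>i\<in>UNIV. ?E (f i))\<^sup>2)"
    using m1 m2 by (intro has_bochner_integral_std_normal_vector_sum_sq) (auto simp: has_bochner_integral_iff)
  moreover have "(\<Sum>i\<in>UNIV. f i (g $ i)) = l1_deriv x (l1_residual x \<tau> g)" for g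
    by (simp add: l1_deriv_residual[OF \<tau>] f_def)
  moreover have "(\<Sum>i\<in>UNIV. ?E (f i)) = (real d - real s) * excess 1 \<tau> - real s * \<tau>"
    using has_bochner_integral_integral_eq[OF m1] by (simp add: sum_support_if del: One_nat_def)
  \<comment> \<open>On the support the variance is exactly 1; off it the variance is bounded by the
    second moment.\<close>
  moreover have "(\<Sum>i\<in>UNIV. ?E (\<lambda>t. (f i t)\<^sup>2) - (?E (f i))\<^sup>2) \<le> (\<Sum>i\<in>UNIV. if x $ i \<noteq> 0 then 1 else excess 2 \<tau>)"
    using has_bochner_integral_integral_eq[OF m1] has_bochner_integral_integral_eq[OF m2]
    by (intro sum_mono) auto
  ultimately show ?deriv by (auto simp: sum_support_if)
qed

lemma s_le_d: "s \<le> d" "0 < d"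
  by (auto simp: s d intro: card_mono)

lemma psi_objective_ratio:
  assumes "0 \<le> \<tau>"
  shows "real d * psi_objective (real s / real d) \<tau> = real s * (1 + \<tau>\<^sup>2) + (real d - real s) * excess 2 \<tau>"
proof -
  have "real d * (real s / real d) = real s" "real d * (1 - real s / real d) = real d - real s"
    using s_le_d by (auto simp: field_simps)
  then show ?thesis
    unfolding psi_objective_excess[OF assms] distrib_left mult.assoc[symmetric] by simp
qed

lemma statistical_dimension_l1_descent_cone_le:
  "statistical_dimension (descent_cone l1_norm x) / real d \<le> psi (real s / real d)"
  unfolding psi_def
proof (intro cINF_greatest)
  fix \<tau> :: real assume "\<tau> \<in> {0..}"
  then have \<tau>: "0 \<le> \<tau>" by simp
  note D = statistical_dimension_polyhedral_cone[OF polyhedral_cone_descent_cone_l1_norm[of x]]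
  have "statistical_dimension (descent_cone l1_norm x) \<le> (\<integral>g. (norm (l1_residual x \<tau> g))\<^sup>2 \<partial>std_normal_vector)"
    unfolding D(1) using expectation_norm_l1_residual(1)[OF \<tau>]
    by (intro integral_mono D(2) norm_closest_point_le_l1_residual[OF \<tau>]) (simp add: has_bochner_integral_iff)
  also have "\<dots> = real d * psi_objective (real s / real d) \<tau>"
    using expectation_norm_l1_residual(1)[OF \<tau>] psi_objective_ratio[OF \<tau>] by (simp add: has_bochner_integral_iff)
  finally show "statistical_dimension (descent_cone l1_norm x) / real d \<le> psi_objective (real s / real d) \<tau>"
    using s_le_d by (simp add: divide_le_eq mult.commute)
qed simp

lemma statistical_dimension_l1_descent_cone_ge:
  assumes s_pos: "0 < s"
  shows "real d * psi (real s / real d) - min 3 (real d / real s)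
      \<le> statistical_dimension (descent_cone l1_norm x)"
proof -
  define \<rho> where "\<rho> = real s / real d"
  have \<rho>: "0 < \<rho>" "\<rho> \<le> 1" using s_pos s_le_d by (auto simp: \<rho>_def)
  obtain \<tau> where \<tau>: "0 \<le> \<tau>" "(1 - \<rho>) * excess 1 \<tau> = \<rho> * \<tau>" using ex_critical[OF \<rho>] by blast
  \<comment> \<open>The critical equation times \<open>d\<close>: the derivative at the residual has
    mean zero, so its second moment is the variance \<open>v\<close>.\<close>
  then have crit: "(real d - real s) * excess 1 \<tau> = real s * \<tau>"
    using s_le_d by (simp add: \<rho>_def field_simps)
  obtain v where v: "v \<le> real s + (real d - real s) * excess 2 \<tau>"
    "has_bochner_integral std_normal_vector (\<lambda>g. (l1_deriv x (l1_residual x \<tau> g))\<^sup>2) v"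
    using expectation_norm_l1_residual(2)[OF \<tau>(1)] unfolding crit by auto
  note Q = expectation_norm_l1_residual(1)[OF \<tau>(1)]
  note D = statistical_dimension_polyhedral_cone[OF polyhedral_cone_descent_cone_l1_norm[of x]]
  have "x \<noteq> 0" using s_pos s by auto
  \<comment> \<open>The projection is a residual at some \<sigma> that depends on \<open>g\<close>;
    strong convexity compares it with the fixed critical \<tau>.\<close>
  have pt: "(norm (l1_residual x \<tau> g))\<^sup>2 - (l1_deriv x (l1_residual x \<tau> g))\<^sup>2 / real s
      \<le> (norm (closest_point (descent_cone l1_norm x) g))\<^sup>2" for g
  proof -
    obtain \<sigma> where "0 \<le> \<sigma>" "closest_point (descent_cone l1_norm x) g = l1_residual x \<sigma> g"
      using ex_closest_point_eq_l1_residual[OF \<open>x \<noteq> 0\<close>] by blast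
    then show ?thesis
      using norm_l1_residual_strongly_convex[OF s s_pos _ \<tau>(1), of \<sigma> g] by simp
  qed
  have hb: "has_bochner_integral std_normal_vector
      (\<lambda>g. (norm (l1_residual x \<tau> g))\<^sup>2 - (l1_deriv x (l1_residual x \<tau> g))\<^sup>2 / real s)
      (real d * psi_objective \<rho> \<tau> - v / real s)"
    unfolding \<rho>_def psi_objective_ratio[OF \<tau>(1)]
    by (intro has_bochner_integral_diff has_bochner_integral_divide_zero Q v(2))
  have "real d * psi_objective \<rho> \<tau> - v / real s
      = (\<integral>g. (norm (l1_residual x \<tau> g))\<^sup>2 - (l1_deriv x (l1_residual x \<tau> g))\<^sup>2 / real s \<partial>std_normal_vector)"
    by (rule has_bochner_integral_integral_eq[OF hb, symmetric])
  also have "\<dots> \<le> statistical_dimension (descent_cone l1_norm x)"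
    unfolding D(1) using hb by (intro integral_mono D(2) pt) (simp add: has_bochner_integral_iff)
  finally have main: "real d * psi_objective \<rho> \<tau> - v / real s \<le> statistical_dimension (descent_cone l1_norm x)" .
  have "real d * psi \<rho> \<le> real d * psi_objective \<rho> \<tau>"
    using \<rho> by (intro mult_left_mono psi_le_objective \<tau>(1)) auto
  moreover have "v / real s \<le> min 3 (real d / real s)"
  proof -
    \<comment> \<open>First variance bound, \<open>v \<le> d\<close>, from
      \<open>excess 2 \<tau> \<le> excess 2 0 = 1\<close>.\<close>
    have "(real d - real s) * excess 2 \<tau> \<le> (real d - real s) * 1"
      using s_le_d excess_antimono[of 0 \<tau> 2] \<tau>(1) excess2_0 by (intro mult_left_mono) auto
    then have "v \<le> real d" using v(1) by simp
    \<comment> \<open>Second variance bound, \<open>v \<le> 3 * s\<close>: after multiplication by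
      \<tau>, \<open>excess 2\<close> is controlled by \<open>excess 1\<close>, which
      \<open>crit\<close> evaluates.\<close>
    moreover have "(real d - real s) * excess 2 \<tau> \<le> 2 * real s"
    proof (cases "\<tau> = 0")
      \<comment> \<open>Division by \<tau> is impossible here, but \<open>crit\<close> and
        \<open>excess 1 0 > 0\<close> force \<open>d = s\<close>.\<close>
      case True
      then show ?thesis using crit excess1_0 by simp
    next
      case False
      have "(real d - real s) * (\<tau> * excess 2 \<tau>) \<le> (real d - real s) * (2 * excess 1 \<tau>)"
        using s_le_d by (intro mult_left_mono excess2_le_excess1 \<tau>(1)) auto
      also have "\<dots> = 2 * (real s * \<tau>)" using crit by simp
      finally have "\<tau> * ((real d - real s) * excess 2 \<tau>) \<le> \<tau> * (2 * real s)" by (simp add: ac_simps)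
      then show ?thesis using \<tau>(1) False by simp
    qed
    then have "v \<le> 3 * real s" using v(1) by simp
    ultimately show ?thesis using s_pos by (simp add: divide_le_eq divide_right_mono)
  qed
  ultimately show ?thesis using main unfolding \<rho>_def by linarith
qed

end

text \<open>Up to 4 the root is at most 2, so \<open>q \<le> 2 * sqrt q\<close>; beyond 4 the right
  side exceeds 3.\<close>

lemma min_3_le_2_sqrt: "min 3 q \<le> 2 * sqrt q" if "0 \<le> q" for q :: real
proof (cases "q \<le> 4")
  case True
  then have "sqrt q \<le> sqrt 4" by (rule real_sqrt_le_mono)
  then have "sqrt q * sqrt q \<le> 2 * sqrt q" using that by (intro mult_right_mono) auto
  then show ?thesis using that by simp
next
  case False
  then have "sqrt 4 \<le> sqrt q" by (intro real_sqrt_le_mono) auto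
  then show ?thesis by simp
qed

theorem proposition4p5:
  fixes x :: "real ^ 'n" and s d :: nat
  assumes d: "d = CARD('n)"
    and s: "s = card {i. x $ i \<noteq> 0}"
  shows "psi (real s / real d) - 2 / sqrt (real s * real d)
           \<le> statistical_dimension (descent_cone l1_norm x) / real d
       \<and> statistical_dimension (descent_cone l1_norm x) / real d \<le> psi (real s / real d)
       \<and> (\<forall>\<rho>\<in>{0..1}. psi \<rho> \<in> {0..1})
       \<and> prob_space (density lborel (\<lambda>u. ennreal (kernel_phi u)))
       \<and> {u. kernel_phi u \<noteq> 0} = {0..}
       \<and> (\<forall>\<rho>\<in>{0<..<1}.
             (\<exists>!\<tau>. 0 < \<tau> \<and> stationary \<rho> \<tau>)
           \<and> (\<forall>\<tau>>0. stationary \<rho> \<tau> \<longrightarrow> psi_objective \<rho> \<tau> = psi \<rho>))"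
proof (intro conjI ballI allI impI)
  let ?D = "descent_cone l1_norm x"
  have d_pos: "0 < d" using s_le_d[OF d s] by auto
  show "psi (real s / real d) - 2 / sqrt (real s * real d) \<le> statistical_dimension ?D / real d"
  proof (cases "s = 0")
    \<comment> \<open>For \<open>s = 0\<close> the error term is a quotient by zero, hence 0, so the
      lower bound rests on \<open>psi 0 \<le> 0\<close>.\<close>
    case True
    have "0 \<le> statistical_dimension ?D"
      unfolding statistical_dimension_polyhedral_cone(1)[OF polyhedral_cone_descent_cone_l1_norm]
      by (intro Bochner_Integration.integral_nonneg) simp
    then have "psi 0 \<le> statistical_dimension ?D / real d"
      by (intro order_trans[OF psi_0] divide_nonneg_nonneg) auto
    then show ?thesis using True by simp
  next
    case False
    then have s_pos: "0 < s" by simp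
    have "real d * psi (real s / real d) - 2 * sqrt (real d / real s) \<le> statistical_dimension ?D"
      using statistical_dimension_l1_descent_cone_ge[OF d s s_pos] min_3_le_2_sqrt[of "real d / real s"] by simp
    then have "(real d * psi (real s / real d) - 2 * sqrt (real d / real s)) / real d \<le> statistical_dimension ?D / real d"
      by (intro divide_right_mono) auto
    moreover have "(2 * sqrt (real d / real s)) / real d = 2 / sqrt (real s * real d)"
    proof -
      have "sqrt (real d) * sqrt (real d) = real d" by simp
      then show ?thesis using d_pos s_pos
        by (simp add: real_sqrt_divide real_sqrt_mult field_simps)
    qed
    ultimately show ?thesis using d_pos by (simp add: diff_divide_distrib)
  qed
  show "statistical_dimension ?D / real d \<le> psi (real s / real d)"
    by (rule statistical_dimension_l1_descent_cone_le[OF d s])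
  show "{u. kernel_phi u \<noteq> 0} = {0..}" by (auto simp: kernel_phi_def)
  fix \<rho> :: real assume \<rho>: "\<rho> \<in> {0<..<1}"
  then show "\<exists>!\<tau>. 0 < \<tau> \<and> stationary \<rho> \<tau>" by (intro ex1_stationary) auto
  fix \<tau> :: real assume "0 < \<tau>" "stationary \<rho> \<tau>"
  then show "psi_objective \<rho> \<tau> = psi \<rho>"
    using \<rho> by (intro psi_eq_objective) (auto simp: stationary_iff_excess)
qed (use psi_range prob_space_kernel_phi in auto)

end
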